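(* Let $\varepsilon>0$ and let $f\in H^1(\Omega)$ be supported in $\Sigma_\varepsilon$. Then $$\Big(\int_{\Sigma_{2\varepsilon}}|f(x)-S_\varepsilon(f)(x)|^2\,\delta(x)\,dx\Big)^{1/2}\le C\varepsilon\Big(\int_{\Sigma_\varepsilon}|\nabla f(x)|^2\,\delta(x)\,dx\Big)^{1/2},$$ where $C$ depends only on $d$ (the mollifier $\zeta$ being fixed).
   Context: $\Omega\subset\mathbb{R}^d$, $d\ge3$, is a bounded Lipschitz domain; $\delta(x)=\mathrm{dist}(x,\partial\Omega)$ for $x\in\Omega$ and $\delta(x)=0$ for $x\in\mathbb{R}^d\setminus\Omega$; $\Sigma_r=\{x\in\Omega:\mathrm{dist}(x,\partial\Omega)>r\}$ for $r>0$. A function $\zeta\in C_0^\infty(B(0,1/2))$ with $\int_{\mathbb{R}^d}\zeta=1$ is fixed once and for all, $\zeta_\varepsilon(x)=\varepsilon^{-d}\zeta(x/\varepsilon)$, and $S_\varepsilon(f)(x)=\int_{\mathbb{R}^d}f(x-y)\zeta_\varepsilon(y)\,dy$, where $f$ is extended by zero outside $\Omega$. *)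

theory Defs
  imports "HOL-Analysis.Analysis"
begin

primrec Ck :: "nat \<Rightarrow> ('a::euclidean_space \<Rightarrow> real) \<Rightarrow> bool" where
  "Ck 0 f \<longleftrightarrow> continuous_on UNIV f"
| "Ck (Suc k) f \<longleftrightarrow>
     (\<forall>x. f differentiable (at x)) \<and> (\<forall>v. Ck k (\<lambda>x. frechet_derivative f (at x) v))"

definition test_functions :: "'a::euclidean_space set \<Rightarrow> ('a \<Rightarrow> real) set" where
  "test_functions U =
     {\<phi>. (\<forall>k. Ck k \<phi>) \<and> compact (closure {x. \<phi> x \<noteq> 0}) \<and> closure {x. \<phi> x \<noteq> 0} \<subseteq> U}"

text \<open>Near every boundary point \<open>z\<close> the set is the part of a ball lying strictly above a
  Lipschitz graph. The unit vector \<open>e\<close> is the vertical axis of the rotated coordinate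
  system centred at \<open>z\<close>, and \<open>\<psi>\<close> matters only on the hyperplane orthogonal
  to \<open>e\<close>. The radius and the Lipschitz constant may depend on \<open>z\<close>; since the boundary
  is compact, this is the same as asking for uniform ones.\<close>

definition bounded_lipschitz_domain :: "'a::euclidean_space set \<Rightarrow> bool" where
  "bounded_lipschitz_domain \<Omega> \<longleftrightarrow>
     open \<Omega> \<and> connected \<Omega> \<and> \<Omega> \<noteq> {} \<and> bounded \<Omega> \<and>
     (\<forall>z\<in>frontier \<Omega>. \<exists>r>0. \<exists>e L \<psi>. norm e = 1 \<and> L-lipschitz_on {y. y \<bullet> e = 0} \<psi> \<and>
        \<Omega> \<inter> ball z r =
          {x \<in> ball z r. (x - z) \<bullet> e > \<psi> ((x - z) - ((x - z) \<bullet> e) *\<^sub>R e)})"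

definition bdist :: "'a::euclidean_space set \<Rightarrow> 'a \<Rightarrow> real" where
  "bdist \<Omega> x = (if x \<in> \<Omega> then infdist x (frontier \<Omega>) else 0)"

definition inner_region :: "'a::euclidean_space set \<Rightarrow> real \<Rightarrow> 'a set" where
  "inner_region \<Omega> r = {x \<in> \<Omega>. infdist x (frontier \<Omega>) > r}"

definition L2 :: "'a::euclidean_space set \<Rightarrow> ('a \<Rightarrow> 'b::euclidean_space) set" where
  "L2 \<Omega> = {f. set_borel_measurable lebesgue \<Omega> f \<and>
              set_integrable lebesgue \<Omega> (\<lambda>x. (norm (f x))\<^sup>2)}"

definition has_weak_gradient ::
  "(real^'n \<Rightarrow> real) \<Rightarrow> (real^'n \<Rightarrow> real^'n) \<Rightarrow> (real^'n) set \<Rightarrow> bool" where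
  "has_weak_gradient f g \<Omega> \<longleftrightarrow>
     (\<forall>\<phi>\<in>test_functions \<Omega>. \<forall>i.
        (LINT x:\<Omega>|lebesgue. f x * frechet_derivative \<phi> (at x) (axis i 1)) =
        - (LINT x:\<Omega>|lebesgue. g x $ i * \<phi> x))"

text \<open>Elements are functions rather than classes modulo null sets, and their values outside
  \<open>\<Omega>\<close> are irrelevant.\<close>

definition H1 :: "(real^'n) set \<Rightarrow> (real^'n \<Rightarrow> real) set" where
  "H1 \<Omega> = {f \<in> L2 \<Omega>. \<exists>g\<in>L2 \<Omega>. has_weak_gradient f g \<Omega>}"

definition rescaled :: "(real^'n \<Rightarrow> real) \<Rightarrow> real \<Rightarrow> real^'n \<Rightarrow> real" where
  "rescaled \<zeta> \<epsilon> x = \<zeta> (x /\<^sub>R \<epsilon>) / \<epsilon> ^ CARD('n)"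

definition zero_extension :: "'a set \<Rightarrow> ('a \<Rightarrow> real) \<Rightarrow> 'a \<Rightarrow> real" where
  "zero_extension \<Omega> f x = (if x \<in> \<Omega> then f x else 0)"

definition smoothing ::
  "(real^'n \<Rightarrow> real) \<Rightarrow> (real^'n) set \<Rightarrow> real \<Rightarrow> (real^'n \<Rightarrow> real) \<Rightarrow> real^'n \<Rightarrow> real" where
  "smoothing \<zeta> \<Omega> \<epsilon> f x =
     (LINT y|lebesgue. zero_extension \<Omega> f (x - y) * rescaled \<zeta> \<epsilon> y)"

end

theory Submission
  imports Defs
begin

text \<open>Let \<open>F\<close> and \<open>G\<close> be Borel versions of the zero extensions of \<open>f\<close> and its weak gradient, and
  \<open>S\<^sub>s F x = \<integral> F (x - s y) \<zeta> y dy\<close>. The kernel satisfies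
  \<open>\<partial>\<^sub>s (s\<^sup>-\<^sup>d \<zeta> ((x - z) / s)) = div\<^sub>z (s\<^sup>-\<^sup>d \<zeta> (w) w)\<close> with \<open>w = (x - z) / s\<close>, so testing
  the weak gradient with this field yields, at every \<open>x\<close> at distance more than \<open>\<epsilon>/2\<close> from the boundary,
  \<open>S\<^sub>\<epsilon> F x - S\<^sub>\<eta> F x = - \<integral>\<^sub>\<eta>\<^sup>\<epsilon> \<integral> G (x - s y) \<bullet> y \<zeta> y dy ds\<close>. Cauchy-Schwarz, Tonelli and
  \<open>\<delta> x \<le> 2 \<delta> (x - s y)\<close> bound the weighted square integral of the left-hand side uniformly
  in \<open>\<eta>\<close>. Finally \<open>S\<^sub>\<eta> F\<close> tends to \<open>F\<close> in L1, hence almost everywhere along a sequence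
  \<open>\<eta> \<rightarrow> 0\<close>, and Fatou's lemma gives the bound for \<open>F - S\<^sub>\<epsilon> F\<close>.\<close>

section \<open>Test functions\<close>

lemma Ck_SucD: "Ck (Suc k) f \<Longrightarrow> Ck k f"
proof (induction k arbitrary: f)
  case 0
  then show ?case
    by (auto intro!: continuous_at_imp_continuous_on differentiable_imp_continuous_within)
next
  case (Suc k)
  then show ?case by (meson Ck.simps(2))
qed

lemma Ck_differentiable: "Ck (Suc k) f \<Longrightarrow> (f has_derivative frechet_derivative f (at x)) (at x)"
  using frechet_derivative_works by auto

lemma Ck_const: "Ck k (\<lambda>x. c)"
  by (induction k arbitrary: c) auto

lemma Ck_add: "Ck k f \<Longrightarrow> Ck k g \<Longrightarrow> Ck k (\<lambda>x. f x + g x)"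
proof (induction k arbitrary: f g)
  case (Suc k)
  have "frechet_derivative (\<lambda>x. f x + g x) (at x) =
      (\<lambda>v. frechet_derivative f (at x) v + frechet_derivative g (at x) v)" for x
    by (intro frechet_derivative_at[symmetric] has_derivative_add Ck_differentiable[OF Suc.prems(1)]
        Ck_differentiable[OF Suc.prems(2)])
  then show ?case using Suc by auto
qed (auto intro: continuous_on_add)

lemma Ck_mult: "Ck k f \<Longrightarrow> Ck k g \<Longrightarrow> Ck k (\<lambda>x. f x * g x)"
proof (induction k arbitrary: f g)
  case (Suc k)
  have "frechet_derivative (\<lambda>x. f x * g x) (at x) =
      (\<lambda>v. f x * frechet_derivative g (at x) v + frechet_derivative f (at x) v * g x)" for x
    by (intro frechet_derivative_at[symmetric] has_derivative_mult Ck_differentiable[OF Suc.prems(1)]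
        Ck_differentiable[OF Suc.prems(2)])
  moreover have "Ck k f" "Ck k g" using Suc.prems Ck_SucD by auto
  ultimately show ?case using Suc by (auto intro!: Ck_add)
qed (auto intro: continuous_on_mult)

lemma Ck_inner: "Ck k (\<lambda>x. x \<bullet> b)"
proof (cases k)
  case (Suc k)
  have "((\<lambda>x. x \<bullet> b) has_derivative (\<lambda>v. v \<bullet> b)) (at x)" for x :: 'a
    by (intro derivative_intros)
  then have "frechet_derivative (\<lambda>x. x \<bullet> b) (at x) = (\<lambda>v. v \<bullet> b)" for x
    using frechet_derivative_at by metis
  then show ?thesis using Suc by (auto simp: Ck_const intro!: derivative_intros differentiableI)
qed (auto intro: continuous_intros)

lemma frechet_derivative_affine:
  fixes f :: "'a::euclidean_space \<Rightarrow> real"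
  assumes "f differentiable (at (a + c *\<^sub>R x))"
  shows "((\<lambda>z. f (a + c *\<^sub>R z)) has_derivative
      (\<lambda>v. frechet_derivative f (at (a + c *\<^sub>R x)) (c *\<^sub>R v))) (at x)"
proof -
  have "((\<lambda>z. a + c *\<^sub>R z) has_derivative (\<lambda>v. c *\<^sub>R v)) (at x)"
    by (auto intro!: derivative_eq_intros)
  from has_derivative_compose[OF this assms[unfolded frechet_derivative_works]] show ?thesis .
qed

lemma Ck_affine: "Ck k f \<Longrightarrow> Ck k (\<lambda>z. f (a + c *\<^sub>R z))"
proof (induction k arbitrary: f)
  case 0
  then show ?case by (auto intro!: continuous_on_compose2[of UNIV f] continuous_intros)
next
  case (Suc k)
  have d: "((\<lambda>z. f (a + c *\<^sub>R z)) has_derivative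
      (\<lambda>v. frechet_derivative f (at (a + c *\<^sub>R x)) (c *\<^sub>R v))) (at x)" for x
    by (rule frechet_derivative_affine) (use Suc.prems in auto)
  have "frechet_derivative (\<lambda>z. f (a + c *\<^sub>R z)) (at x) =
      (\<lambda>v. frechet_derivative f (at (a + c *\<^sub>R x)) (c *\<^sub>R v))" for x
    by (intro frechet_derivative_at[symmetric] d)
  \<comment> \<open>By the chain rule, a directional derivative of the composite is the derivative
    of \<open>f\<close> in direction \<open>c *\<^sub>R v\<close>, composed with the same affine
    map. The induction hypothesis covers it because \<open>Ck\<close> asks for every
    direction.\<close>
  then show ?case using Suc.prems d Suc.IH[of "\<lambda>x. frechet_derivative f (at x) (c *\<^sub>R v)" for v]
    by (auto intro: differentiableI)
qed

text \<open>Compact sets are closed, so any compact \<open>K\<close> off which \<open>\<phi>\<close>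
  vanishes contains the support; no closure has to be computed for products and rescalings.\<close>

lemma test_functionsI:
  assumes "\<And>k. Ck k \<phi>" "compact K" "K \<subseteq> U" "\<And>x. x \<notin> K \<Longrightarrow> \<phi> x = 0"
  shows "\<phi> \<in> test_functions U"
proof -
  have "closure {x. \<phi> x \<noteq> 0} \<subseteq> K"
    using assms by (intro closure_minimal) (auto simp: compact_imp_closed)
  with assms compact_Int_closed[OF assms(2) closed_closure[of "{x. \<phi> x \<noteq> 0}"]]
  show ?thesis by (auto simp: test_functions_def Int_absorb1)
qed

lemma test_functionsE:
  assumes "\<phi> \<in> test_functions U"
  obtains K where "\<And>k. Ck k \<phi>" "compact K" "K \<subseteq> U" "\<And>x. x \<notin> K \<Longrightarrow> \<phi> x = 0"
  using assms that[of "closure {x. \<phi> x \<noteq> 0}"] subsetD[OF closure_subset, of _ "{x. \<phi> x \<noteq> 0}"]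
  unfolding test_functions_def by blast

lemma test_functions_times_smooth:
  assumes "\<phi> \<in> test_functions U" "\<And>k. Ck k h"
  shows "(\<lambda>x. \<phi> x * h x) \<in> test_functions U"
proof -
  from assms(1) obtain K where K: "\<And>k. Ck k \<phi>" "compact K" "K \<subseteq> U" "\<And>x. x \<notin> K \<Longrightarrow> \<phi> x = 0"
    by (rule test_functionsE) blast
  show ?thesis
    by (rule test_functionsI[OF _ K(2,3)]) (simp_all add: K assms(2) Ck_mult)
qed

text \<open>If \<open>\<phi>\<close> vanishes off \<open>K\<close>, the rescaled function vanishes
  off the compact set of all \<open>x - s *\<^sub>R w\<close> with \<open>w\<close> in
  \<open>K\<close>, which lies in the ball of radius \<open>s * r\<close> about \<open>x\<close>.
  With \<open>r = 1/2\<close> this makes rescaled kernels admissible in the weak gradient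
  identity.\<close>

lemma test_functions_affine:
  assumes \<phi>: "\<phi> \<in> test_functions (ball 0 r)" and s: "s > 0" and sub: "ball x (s * r) \<subseteq> U"
  shows "(\<lambda>z. \<phi> ((x - z) /\<^sub>R s)) \<in> test_functions U"
proof -
  from \<phi> obtain K where K: "\<And>k. Ck k \<phi>" "compact K" "K \<subseteq> ball 0 r" "\<And>x. x \<notin> K \<Longrightarrow> \<phi> x = 0"
    by (rule test_functionsE) blast
  show ?thesis
  proof (rule test_functionsI[where K="(\<lambda>w. x - s *\<^sub>R w) ` K"])
    have eq: "(\<lambda>z. \<phi> ((x - z) /\<^sub>R s)) = (\<lambda>z. \<phi> (x /\<^sub>R s + (- inverse s) *\<^sub>R z))"
      by (simp add: algebra_simps)
    show "Ck k (\<lambda>z. \<phi> ((x - z) /\<^sub>R s))" for k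
      unfolding eq by (rule Ck_affine) (rule K)
    show "compact ((\<lambda>w. x - s *\<^sub>R w) ` K)"
      by (intro compact_continuous_image continuous_intros K)
    have "x - s *\<^sub>R w \<in> ball x (s * r)" if "w \<in> K" for w
      using that K(3) s by (auto simp: dist_norm)
    then show "(\<lambda>w. x - s *\<^sub>R w) ` K \<subseteq> U" using sub by auto
    show "\<phi> ((x - z) /\<^sub>R s) = 0" if "z \<notin> (\<lambda>w. x - s *\<^sub>R w) ` K" for z
    proof (rule K)
      have "z = x - s *\<^sub>R ((x - z) /\<^sub>R s)" using s by simp
      then show "(x - z) /\<^sub>R s \<notin> K" using that by blast
    qed
  qed
qed

section \<open>Translations in L1\<close>

lemma lborel_affine_change:
  fixes f :: "'a::euclidean_space \<Rightarrow> 'b::{banach, second_countable_topology}"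
  assumes [measurable]: "f \<in> borel_measurable borel" and c: "c \<noteq> 0"
  shows lborel_integral_affine:
      "(LINT x|lborel. f x) = \<bar>c\<bar> ^ DIM('a) *\<^sub>R (LINT x|lborel. f (t + c *\<^sub>R x))"
    and lborel_integrable_affine_iff:
      "integrable lborel (\<lambda>x. f (t + c *\<^sub>R x)) \<longleftrightarrow> integrable lborel f"
proof -
  show "(LINT x|lborel. f x) = \<bar>c\<bar> ^ DIM('a) *\<^sub>R (LINT x|lborel. f (t + c *\<^sub>R x))"
    by (subst lborel_affine[OF c, of t])
      (subst integral_density; simp add: integral_distr)
  show "integrable lborel (\<lambda>x. f (t + c *\<^sub>R x)) \<longleftrightarrow> integrable lborel f"
    using c integrable_scaleR_right[of "inverse (\<bar>c\<bar> ^ DIM('a))" lborel "\<lambda>x. \<bar>c\<bar> ^ DIM('a) *\<^sub>R f (t + c *\<^sub>R x)"]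
    by (subst (2) lborel_affine[OF c, of t]) (auto simp: integrable_density integrable_distr_eq)
qed

lemma lborel_nn_integral_affine:
  fixes f :: "'a::euclidean_space \<Rightarrow> ennreal"
  assumes [measurable]: "f \<in> borel_measurable borel" and c: "c \<noteq> 0"
  shows "(\<integral>\<^sup>+x. f x \<partial>lborel) = ennreal (\<bar>c\<bar> ^ DIM('a)) * (\<integral>\<^sup>+x. f (t + c *\<^sub>R x) \<partial>lborel)"
  by (subst lborel_affine[OF c, of t])
    (simp add: nn_integral_density nn_integral_distr nn_integral_cmult ennreal_power)

lemma AE_lborel_affine:
  fixes P :: "'a::euclidean_space \<Rightarrow> bool"
  assumes "AE x in lborel. P x" and c: "c \<noteq> 0"
  shows "AE x in lborel. P (t + c *\<^sub>R x)"
proof -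
  have "AE x in density (distr lborel borel (\<lambda>x. t + c *\<^sub>R x)) (\<lambda>_. \<bar>c\<bar> ^ DIM('a)). P x"
    using assms(1) by (simp only: lborel_affine[OF c, of t, symmetric])
  then have "AE x in distr lborel borel (\<lambda>x. t + c *\<^sub>R x). P x"
    using c by (subst (asm) AE_density) auto
  then show ?thesis by (rule AE_distrD[rotated]) simp
qed

lemma lborel_translate:
  fixes f :: "'a::euclidean_space \<Rightarrow> real"
  assumes f: "integrable lborel f"
  shows lborel_integrable_translate: "integrable lborel (\<lambda>x. f (x - v))"
    and lborel_integral_abs_translate: "(LINT x|lborel. \<bar>f (x - v)\<bar>) = (LINT x|lborel. \<bar>f x\<bar>)"
  using f lborel_integrable_affine_iff[of f 1 "-v"]
    lborel_integral_affine[of "\<lambda>x. \<bar>f x\<bar>" 1 "-v"] by auto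

text \<open>Uniformity in \<open>v\<close> is the point: the bound provides the majorant when
  translates are averaged against the kernel.\<close>

lemma integral_abs_translate_diff_le:
  fixes f :: "'a::euclidean_space \<Rightarrow> real"
  assumes f: "integrable lborel f"
  shows "(LINT x|lborel. \<bar>f (x - v) - f x\<bar>) \<le> 2 * (LINT x|lborel. \<bar>f x\<bar>)"
proof -
  note i = lborel_translate[OF f, of v]
  have "(LINT x|lborel. \<bar>f (x - v) - f x\<bar>) \<le> (LINT x|lborel. \<bar>f (x - v)\<bar> + \<bar>f x\<bar>)"
    using i(1) f by (intro integral_mono) auto
  then show ?thesis using i f by simp
qed

text \<open>Two approximations by dominated convergence. First \<open>F\<close> is truncated in size
  by \<open>clamp\<close> and in space by \<open>cut\<close>; then \<open>F\<close> inside the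
  truncation is replaced by continuous functions converging to it almost everywhere. The truncation
  gives these a common bound and a common bounded support.\<close>

lemma continuous_compact_support_L1_dense:
  fixes F :: "'a::euclidean_space \<Rightarrow> real"
  assumes F: "integrable lborel F" and e: "e > 0"
  obtains \<phi> R where "continuous_on UNIV \<phi>" "\<And>x. norm x > R \<Longrightarrow> \<phi> x = 0"
    "(LINT x|lborel. \<bar>F x - \<phi> x\<bar>) < e"
proof -
  define cut where "cut k x = max 0 (min 1 (real k + 1 - norm x))" for k and x :: 'a
  define clamp where "clamp k t = max (- real k) (min (real k) t)" for k and t :: real
  have Fm [measurable]: "F \<in> borel_measurable borel" using F by auto
  have cutc: "continuous_on UNIV (cut k)" for k unfolding cut_def by (intro continuous_intros)
  have clc: "continuous_on UNIV (clamp k)" for k unfolding clamp_def by (intro continuous_intros)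
  have [measurable]: "cut k \<in> borel_measurable borel" "clamp k \<in> borel_measurable borel" for k
    using cutc clc by (auto intro: borel_measurable_continuous_onI)
  have cut01: "0 \<le> cut k x" "cut k x \<le> 1" for k x by (auto simp: cut_def)
  have cl1: "\<bar>clamp k t\<bar> \<le> \<bar>t\<bar>" "\<bar>clamp k t\<bar> \<le> real k" for k t by (auto simp: clamp_def)
  define Fk where "Fk k x = clamp k (F x) * cut k x" for k x
  have [measurable]: "Fk k \<in> borel_measurable borel" for k unfolding Fk_def by measurable
  have Fkle: "\<bar>Fk k x\<bar> \<le> \<bar>F x\<bar>" for k x
    using mult_left_le[OF cut01(2)[of k x] abs_ge_zero[of "clamp k (F x)"]] cl1(1)[of k "F x"] cut01(1)[of k x]
    by (simp add: Fk_def abs_mult)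
  have ev: "eventually (\<lambda>k. Fk k x = F x) sequentially" for x
  proof -
    \<comment> \<open>Beyond this index neither truncation acts at \<open>x\<close>:
      \<open>clamp\<close> fixes \<open>F x\<close> and \<open>cut\<close> equals 1 there.\<close>
    obtain N where N: "real N \<ge> max \<bar>F x\<bar> (norm x)" using real_arch_simple by blast
    show ?thesis
      using eventually_ge_at_top[of N]
      by eventually_elim (use N in \<open>simp add: Fk_def clamp_def cut_def max_absorb2 min_absorb2 min_absorb1 abs_le_iff\<close>)
  qed
  have "(\<lambda>k. LINT x|lborel. \<bar>F x - Fk k x\<bar>) \<longlonglongrightarrow> (LINT x::'a|lborel. 0)"
  proof (rule integral_dominated_convergence[where w="\<lambda>x. 2 * \<bar>F x\<bar>"])
    show "AE x in lborel. (\<lambda>k. \<bar>F x - Fk k x\<bar>) \<longlonglongrightarrow> 0"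
    proof (intro AE_I2 tendsto_eventually)
      show "eventually (\<lambda>k. \<bar>F x - Fk k x\<bar> = 0) sequentially" for x
        using ev[of x] by eventually_elim simp
    qed
    show "AE x in lborel. norm \<bar>F x - Fk k x\<bar> \<le> 2 * \<bar>F x\<bar>" for k
      using Fkle[of k] by (intro AE_I2) (smt (verit) real_norm_def)
  qed (use F in auto)
  then have "eventually (\<lambda>k. (LINT x|lborel. \<bar>F x - Fk k x\<bar>) < e/2) sequentially"
    using e by (intro order_tendstoD) auto
  then obtain k where k: "(LINT x|lborel. \<bar>F x - Fk k x\<bar>) < e/2"
    by (auto simp: eventually_sequentially)
  \<comment> \<open>\<open>measurable_on\<close> yields continuous functions converging to
    \<open>F\<close> off a negligible set, with no control of their size or support.\<close>
  have "F measurable_on UNIV"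
    by (rule lebesgue_measurable_imp_measurable_on) (auto simp: measurable_completion)
  then obtain N g where N: "negligible N" and g: "\<And>n. continuous_on UNIV (g n)"
    and lim: "\<And>x. x \<notin> N \<Longrightarrow> (\<lambda>n. g n x) \<longlonglongrightarrow> F x"
    by (auto simp: measurable_on_def)
  define \<phi> where "\<phi> n x = clamp k (g n x) * cut k x" for n x
  have \<phi>c: "continuous_on UNIV (\<phi> n)" for n
    unfolding \<phi>_def using continuous_on_compose2[OF clc g] by (intro continuous_intros cutc) auto
  then have [measurable]: "\<phi> n \<in> borel_measurable borel" for n
    by (auto intro: borel_measurable_continuous_onI)
  have AEN: "AE x in lborel. x \<notin> N"
    using N by (metis negligible_iff_null_sets AE_not_in AE_completion_iff)
  have bnd: "\<bar>clamp k t * cut k x\<bar> \<le> real k * indicator (cball 0 (real k + 1)) x" for t x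
  proof (cases "norm x \<le> real k + 1")
    case True
    then show ?thesis
      using mult_left_le[OF cut01(2)[of k x] abs_ge_zero[of "clamp k t"]] cl1(2)[of k t] cut01(1)[of k x]
      by (simp add: abs_mult)
  qed (auto simp: cut_def)
  have ib: "integrable lborel (\<lambda>x::'a. real k * indicator (cball 0 (real k + 1)) x :: real)"
    by (intro integrable_mult_right integrable_real_indicator) (use emeasure_bounded_finite[OF bounded_cball] in auto)
  have "(\<lambda>n. LINT x|lborel. \<bar>Fk k x - \<phi> n x\<bar>) \<longlonglongrightarrow> (LINT x::'a|lborel. 0)"
  proof (rule integral_dominated_convergence[where
        w="\<lambda>x. 2 * (real k * indicator (cball 0 (real k + 1)) x)"])
    show "AE x in lborel. (\<lambda>n. \<bar>Fk k x - \<phi> n x\<bar>) \<longlonglongrightarrow> 0"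
      using AEN
    proof eventually_elim
      case (elim x)
      have "isCont (clamp k) (F x)" using clc by (simp add: continuous_on_eq_continuous_at)
      from isCont_tendsto_compose[OF this lim[OF elim]]
      have "(\<lambda>n. \<phi> n x) \<longlonglongrightarrow> Fk k x" unfolding \<phi>_def Fk_def by (intro tendsto_intros)
      then have "(\<lambda>n. \<bar>Fk k x - \<phi> n x\<bar>) \<longlonglongrightarrow> \<bar>Fk k x - Fk k x\<bar>" by (intro tendsto_intros)
      then show ?case by simp
    qed
    show "AE x in lborel. norm \<bar>Fk k x - \<phi> n x\<bar> \<le> 2 * (real k * indicator (cball 0 (real k + 1)) x)" for n
      unfolding \<phi>_def Fk_def
      by (intro AE_I2) (smt (verit) bnd real_norm_def)
    show "integrable lborel (\<lambda>x::'a. 2 * (real k * indicator (cball 0 (real k + 1)) x) :: real)"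
      by (rule integrable_mult_right) (rule ib)
  qed auto
  then have "eventually (\<lambda>n. (LINT x|lborel. \<bar>Fk k x - \<phi> n x\<bar>) < e/2) sequentially"
    using e by (intro order_tendstoD) auto
  then obtain n where n: "(LINT x|lborel. \<bar>Fk k x - \<phi> n x\<bar>) < e/2"
    by (auto simp: eventually_sequentially)
  have iF: "integrable lborel (Fk k)"
    by (rule Bochner_Integration.integrable_bound[OF F]) (auto intro!: AE_I2 Fkle)
  have i\<phi>: "integrable lborel (\<phi> n)"
    by (rule Bochner_Integration.integrable_bound[OF ib])
      (use bnd in \<open>auto intro!: AE_I2 simp: \<phi>_def\<close>)
  have "(LINT x|lborel. \<bar>F x - \<phi> n x\<bar>) \<le> (LINT x|lborel. \<bar>F x - Fk k x\<bar> + \<bar>Fk k x - \<phi> n x\<bar>)"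
    using F iF i\<phi> by (intro integral_mono) auto
  also have "\<dots> = (LINT x|lborel. \<bar>F x - Fk k x\<bar>) + (LINT x|lborel. \<bar>Fk k x - \<phi> n x\<bar>)"
    using F iF i\<phi> by (intro Bochner_Integration.integral_add) auto
  also have "\<dots> < e" using k n by simp
  finally show thesis
    by (rule that[OF \<phi>c, rotated, where R = "real k + 1"]) (auto simp: \<phi>_def cut_def)
qed

text \<open>For a continuous \<open>\<phi>\<close> of bounded support the claim is dominated
  convergence, since a bounded sequence of shifts keeps all translates inside one ball. Replacing
  \<open>F\<close> by \<open>\<phi>\<close> costs the L1 norm of \<open>F - \<phi>\<close> twice, by
  translation invariance.\<close>

lemma translation_tendsto_L1:
  fixes F :: "'a::euclidean_space \<Rightarrow> real"
  assumes F: "integrable lborel F" and h: "h \<longlonglongrightarrow> 0"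
  shows "(\<lambda>n. LINT x|lborel. \<bar>F (x - h n) - F x\<bar>) \<longlonglongrightarrow> 0"
proof (rule LIMSEQ_I)
  fix e :: real assume "e > 0"
  then have "e / 3 > 0" by simp
  from continuous_compact_support_L1_dense[OF F this]
  obtain \<phi> R where c: "continuous_on UNIV \<phi>" and R: "\<And>x. norm x > R \<Longrightarrow> \<phi> x = 0"
    and close: "(LINT x|lborel. \<bar>F x - \<phi> x\<bar>) < e / 3" by blast
  have [measurable]: "F \<in> borel_measurable borel" using F by auto
  have [measurable]: "\<phi> \<in> borel_measurable borel" using c by (rule borel_measurable_continuous_onI)
  have "compact (\<phi> ` cball 0 R)"
    using c by (intro compact_continuous_image) (auto intro: continuous_on_subset)
  then obtain M0 where M0: "\<And>x. x \<in> cball 0 R \<Longrightarrow> \<bar>\<phi> x\<bar> \<le> M0"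
    using compact_imp_bounded bounded_iff by (metis imageI real_norm_def)
  \<comment> \<open>If \<open>R\<close> is negative the ball is empty and \<open>M0\<close> may be
    negative; the maximum keeps the majorant nonnegative.\<close>
  define M where "M = max M0 0"
  have M: "\<bar>\<phi> x\<bar> \<le> M * indicator (cball 0 R) x" for x
    using M0[of x] R[of x] by (cases "norm x \<le> R") (auto simp: M_def)
  obtain B where B: "\<And>n. norm (h n) \<le> B"
    using convergent_imp_bounded[OF h] by (auto simp: bounded_iff)
  have ind: "\<bar>\<phi> (x - v)\<bar> \<le> M * indicator (cball 0 (R + B)) x" if "norm v \<le> B" for x v
  proof -
    have "norm x \<le> norm (x - v) + norm v" using norm_triangle_ineq[of "x - v" v] by simp
    then show ?thesis using M[of "x - v"] that
      by (cases "norm (x - v) \<le> R"; cases "norm x \<le> R + B") (auto simp: M_def)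
  qed
  have iK: "integrable lborel (\<lambda>x::'a. M * indicator (cball 0 r) x)" for r
    by (intro integrable_mult_right integrable_real_indicator) (use emeasure_bounded_finite[OF bounded_cball] in auto)
  have i\<phi>: "integrable lborel \<phi>"
    by (rule Bochner_Integration.integrable_bound[OF iK[of R]]) (auto intro!: AE_I2 M[THEN order_trans])
  have "(\<lambda>n. LINT x|lborel. \<bar>\<phi> (x - h n) - \<phi> x\<bar>) \<longlonglongrightarrow> (LINT x::'a|lborel. 0)"
  proof (rule integral_dominated_convergence[where
        w="\<lambda>x. M * indicator (cball 0 (R + B)) x + M * indicator (cball 0 R) x"])
    show "integrable lborel (\<lambda>x::'a. M * indicator (cball 0 (R + B)) x + M * indicator (cball 0 R) x)"
      by (intro Bochner_Integration.integrable_add iK)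
    have "(\<lambda>n. \<bar>\<phi> (x - h n) - \<phi> x\<bar>) \<longlonglongrightarrow> \<bar>\<phi> (x - 0) - \<phi> x\<bar>" for x
      using c by (intro tendsto_intros isCont_tendsto_compose[of _ \<phi>] h)
        (auto simp: continuous_on_eq_continuous_at)
    then show "AE x in lborel. (\<lambda>n. \<bar>\<phi> (x - h n) - \<phi> x\<bar>) \<longlonglongrightarrow> 0" by simp
    show "AE x in lborel. norm \<bar>\<phi> (x - h n) - \<phi> x\<bar>
        \<le> M * indicator (cball 0 (R + B)) x + M * indicator (cball 0 R) x" for n
    proof (rule AE_I2)
      show "norm \<bar>\<phi> (x - h n) - \<phi> x\<bar>
        \<le> M * indicator (cball 0 (R + B)) x + M * indicator (cball 0 R) x" for x
        using ind[OF B[of n], of x] M[of x] unfolding real_norm_def by linarith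
    qed
  qed auto
  then have "eventually (\<lambda>n. (LINT x|lborel. \<bar>\<phi> (x - h n) - \<phi> x\<bar>) < e / 3) sequentially"
    using \<open>e > 0\<close> by (intro order_tendstoD) auto
  then obtain N where N: "\<And>n. n \<ge> N \<Longrightarrow> (LINT x|lborel. \<bar>\<phi> (x - h n) - \<phi> x\<bar>) < e / 3"
    by (auto simp: eventually_sequentially)
  have "norm ((LINT x|lborel. \<bar>F (x - h n) - F x\<bar>) - 0) < e" if "n \<ge> N" for n
  proof -
    let ?D = "\<lambda>x. F x - \<phi> x"
    have iD: "integrable lborel ?D" using F i\<phi> by auto
    have ish: "integrable lborel (\<lambda>x. F (x - h n))" "integrable lborel (\<lambda>x. \<phi> (x - h n))"
      by (rule lborel_translate, fact)+
    have "(LINT x|lborel. \<bar>F (x - h n) - F x\<bar>)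
        \<le> (LINT x|lborel. \<bar>?D (x - h n)\<bar> + \<bar>\<phi> (x - h n) - \<phi> x\<bar> + \<bar>?D x\<bar>)"
      using F i\<phi> ish by (intro integral_mono) auto
    also have "\<dots> = (LINT x|lborel. \<bar>?D (x - h n)\<bar>) + (LINT x|lborel. \<bar>\<phi> (x - h n) - \<phi> x\<bar>)
        + (LINT x|lborel. \<bar>?D x\<bar>)"
      using F i\<phi> ish by (subst Bochner_Integration.integral_add) auto
    also have "\<dots> < e" using lborel_translate(2)[OF iD, of "h n"] close N[OF that] by simp
    finally show ?thesis by simp
  qed
  then show "\<exists>no. \<forall>n\<ge>no. norm ((LINT x|lborel. \<bar>F (x - h n) - F x\<bar>) - 0) < e" by blast
qed

section \<open>The mollifier\<close>

lemma integrable_bounded_mult: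
  fixes F h :: "'a \<Rightarrow> real"
  assumes F: "integrable M F" and [measurable]: "h \<in> borel_measurable M" and B: "\<And>x. \<bar>h x\<bar> \<le> B"
  shows "integrable M (\<lambda>x. F x * h x)"
proof (rule Bochner_Integration.integrable_bound)
  show "integrable M (\<lambda>x. B * F x)" using F by simp
  show "AE x in M. norm (F x * h x) \<le> norm (B * F x)"
  proof (rule AE_I2)
    fix x
    have "\<bar>h x\<bar> * \<bar>F x\<bar> \<le> \<bar>B\<bar> * \<bar>F x\<bar>"
      using B[of x] by (intro mult_right_mono) linarith+
    then show "norm (F x * h x) \<le> norm (B * F x)" by (simp add: abs_mult mult.commute)
  qed
qed (use F in measurable)

text \<open>A non-integrable function has Bochner integral 0 by convention, which makes the bound
  trivial; so averages of \<open>G\<close> can be estimated before their integrability is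
  known.\<close>

lemma ennreal_norm_integral_le:
  fixes f :: "'a \<Rightarrow> 'b::{banach, second_countable_topology}"
  shows "ennreal (norm (integral\<^sup>L M f)) \<le> (\<integral>\<^sup>+x. ennreal (norm (f x)) \<partial>M)"
proof (cases "integrable M f")
  case True
  then show ?thesis by (rule integral_norm_bound_ennreal)
qed (simp add: not_integrable_integral_eq)

lemma continuous_zero_off_compact_bounded:
  fixes f :: "'a::euclidean_space \<Rightarrow> real"
  assumes "continuous_on UNIV f" "compact K" "\<And>x. x \<notin> K \<Longrightarrow> f x = 0"
  obtains B where "\<And>x. \<bar>f x\<bar> \<le> B"
proof -
  have "bounded (f ` K)"
    using assms by (intro compact_imp_bounded compact_continuous_image continuous_on_subset[OF assms(1)]) auto
  then obtain B where "\<And>x. x \<in> K \<Longrightarrow> \<bar>f x\<bar> \<le> B" by (auto simp: bounded_iff)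
  then have "\<bar>f x\<bar> \<le> max B 0" for x using assms(3) by (cases "x \<in> K") (auto simp: le_max_iff_disj)
  then show thesis by (rule that)
qed

locale mollifier =
  fixes \<zeta> :: "real^'n \<Rightarrow> real"
  assumes test_kernel: "\<zeta> \<in> test_functions (ball 0 (1/2))"
    and integral_eq_1: "(LINT x|lebesgue. \<zeta> x) = 1"
begin

abbreviation D\<zeta> :: "'n \<Rightarrow> real^'n \<Rightarrow> real" where
  "D\<zeta> i y \<equiv> frechet_derivative \<zeta> (at y) (axis i 1)"

text \<open>The divergence of \<open>y \<mapsto> \<zeta> y *\<^sub>R y\<close>; it is also \<open>- \<partial>/\<partial>s\<close> of
  \<open>\<zeta> (y /\<^sub>R s) / s ^ CARD('n)\<close> at \<open>s = 1\<close>, and this coincidence turns the derivative of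
  the mollification in \<open>s\<close> into an average of the gradient.\<close>

definition div\<zeta> :: "real^'n \<Rightarrow> real" where
  "div\<zeta> y = (\<Sum>i\<in>UNIV. \<zeta> y + y $ i * D\<zeta> i y)"

lemma Ck_kernel: "Ck k \<zeta>" using test_kernel by (simp add: test_functions_def)

lemma has_derivative_kernel: "(\<zeta> has_derivative frechet_derivative \<zeta> (at y)) (at y)"
  by (rule Ck_differentiable) (rule Ck_kernel)

lemma continuous_kernel: "continuous_on UNIV \<zeta>" using Ck_kernel[of 0] by simp

lemma continuous_partial: "continuous_on UNIV (D\<zeta> i)" using Ck_kernel[of 1] by simp

lemma continuous_div_kernel: "continuous_on UNIV div\<zeta>"
  unfolding div\<zeta>_def by (intro continuous_intros continuous_kernel continuous_partial)

lemma measurable_kernel [measurable]: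
  "\<zeta> \<in> borel_measurable borel" "D\<zeta> i \<in> borel_measurable borel" "div\<zeta> \<in> borel_measurable borel"
  by (intro borel_measurable_continuous_onI continuous_kernel continuous_partial continuous_div_kernel)+

text \<open>One compact set serves the kernel and its partial derivatives, because the kernel is
  constantly 0 on the open complement of \<open>K\<close>.\<close>

lemma kernel_support:
  obtains K where "compact K" "K \<subseteq> ball 0 (1/2)" "\<And>y. y \<notin> K \<Longrightarrow> \<zeta> y = 0"
    "\<And>y i. y \<notin> K \<Longrightarrow> D\<zeta> i y = 0"
proof -
  obtain K where K: "compact K" "K \<subseteq> ball 0 (1/2)" "\<And>y. y \<notin> K \<Longrightarrow> \<zeta> y = 0"
    using test_kernel by (rule test_functionsE) blast
  have "frechet_derivative \<zeta> (at y) = (\<lambda>_. 0)" if "y \<notin> K" for y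
  proof (rule frechet_derivative_at[symmetric])
    have "open (- K)" using K(1) by (simp add: compact_imp_closed open_Compl)
    then show "(\<zeta> has_derivative (\<lambda>_. 0)) (at y)"
      using that K(3) by (intro has_derivative_transform_within_open[OF has_derivative_const[of 0]]) auto
  qed
  with K show thesis by (intro that) auto
qed

lemma kernel_zero_outside: "norm y \<ge> 1/2 \<Longrightarrow> \<zeta> y = 0"
  by (rule kernel_support) (force simp: subset_iff)

lemma bounded_product:
  assumes "continuous_on UNIV p"
  obtains B where "\<And>y. \<bar>\<zeta> y * p y\<bar> \<le> B"
proof (rule kernel_support)
  fix K assume K: "compact K" "\<And>y. y \<notin> K \<Longrightarrow> \<zeta> y = 0"
  show thesis
    by (rule continuous_zero_off_compact_bounded[of "\<lambda>y. \<zeta> y * p y" K])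
      (use K that assms in \<open>auto intro!: continuous_intros continuous_kernel\<close>)
qed

lemma bounded_D_product:
  obtains B where "\<And>y. \<bar>y $ i * D\<zeta> i y\<bar> \<le> B"
proof (rule kernel_support)
  fix K assume K: "compact K" "\<And>y i. y \<notin> K \<Longrightarrow> D\<zeta> i y = 0"
  show thesis
    by (rule continuous_zero_off_compact_bounded[of "\<lambda>y. y $ i * D\<zeta> i y" K])
      (use K that in \<open>auto intro!: continuous_intros continuous_partial\<close>)
qed

lemma bounded_div:
  obtains B where "\<And>y. \<bar>div\<zeta> y\<bar> \<le> B"
proof (rule kernel_support)
  fix K assume K: "compact K" "\<And>y. y \<notin> K \<Longrightarrow> \<zeta> y = 0" "\<And>y i. y \<notin> K \<Longrightarrow> D\<zeta> i y = 0"
  have "div\<zeta> y = 0" if "y \<notin> K" for y using K that by (simp add: div\<zeta>_def)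
  from continuous_zero_off_compact_bounded[OF continuous_div_kernel K(1) this] that show thesis by blast
qed

lemma integrable_kernel: "integrable lborel \<zeta>"
proof -
  obtain B where B: "\<And>y. \<bar>\<zeta> y * 1\<bar> \<le> B"
    using bounded_product[OF continuous_on_const[of UNIV 1]] by blast
  have "integrable lborel (\<lambda>y. indicator (ball 0 (1/2)) y * \<zeta> y)"
    by (rule integrable_bounded_mult[of _ _ _ B], rule integrable_real_indicator)
      (use emeasure_bounded_finite[OF bounded_ball[of "0::real^'n" "1/2"]] B in auto)
  also have "(\<lambda>y. indicator (ball 0 (1/2)) y * \<zeta> y) = \<zeta>"
    using kernel_zero_outside by (force simp: indicator_def)
  finally show ?thesis .
qed

lemma integral_kernel: "(LINT y|lborel. \<zeta> y) = 1"
  using integral_eq_1 by (simp add: integral_completion)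

abbreviation \<zeta>norm :: real where "\<zeta>norm \<equiv> (LINT y|lborel. \<bar>\<zeta> y\<bar>)"

text \<open>A consequence of the unit integral; it makes the final constant positive.\<close>

lemma integral_abs_kernel_ge_1: "\<zeta>norm \<ge> 1"
  using integral_abs_bound[of lborel \<zeta>] integral_kernel by simp

text \<open>With \<open>w = v /\<^sub>R s\<close>, the point \<open>w\<close> moves with velocity
  \<open>- w /\<^sub>R s\<close>, so the chain rule contributes minus the radial derivative of
  \<zeta> at \<open>w\<close>, and the power of \<open>s\<close> contributes
  \<open>- CARD('n) * \<zeta> w\<close>, both over \<open>s ^ Suc CARD('n)\<close>. Together they
  are the divergence of \<open>\<zeta> w *\<^sub>R w\<close>.\<close>

lemma DERIV_rescaled:
  assumes s: "s > 0"
  shows "((\<lambda>s. \<zeta> (v /\<^sub>R s) / s ^ CARD('n)) has_real_derivative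
     - div\<zeta> (v /\<^sub>R s) / s ^ Suc CARD('n)) (at s)"
proof -
  let ?w = "v /\<^sub>R s" let ?L = "frechet_derivative \<zeta> (at ?w)"
  have lin: "linear ?L" using has_derivative_kernel has_derivative_linear by blast
  have L: "?L ?w = (\<Sum>i\<in>UNIV. ?w $ i * D\<zeta> i ?w)"
    by (subst basis_expansion[symmetric, of ?w])
      (simp add: linear_sum[OF lin] linear_cmul[OF lin] scalar_mult_eq_scaleR del: basis_expansion)
  have "((\<lambda>s. v /\<^sub>R s) has_vector_derivative (- (1 / s)) *\<^sub>R ?w) (at s)"
    using s by (auto intro!: derivative_eq_intros simp: power2_eq_square divide_simps)
  then have "((\<lambda>s. v /\<^sub>R s) has_derivative (\<lambda>h. h *\<^sub>R (- (1 / s)) *\<^sub>R ?w)) (at s)"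
    by (simp add: has_vector_derivative_def)
  from has_derivative_compose[OF this has_derivative_kernel]
  have "((\<lambda>s. \<zeta> (v /\<^sub>R s)) has_derivative (\<lambda>h. (- (1 / s) * ?L ?w) * h)) (at s)"
    by (rule has_derivative_eq_rhs) (simp add: fun_eq_iff linear_cmul[OF lin] linear_neg[OF lin])
  then have "((\<lambda>s. \<zeta> (v /\<^sub>R s)) has_real_derivative (- (1 / s) * ?L ?w)) (at s)"
    unfolding has_field_derivative_def .
  from DERIV_divide[OF this DERIV_pow, of "CARD('n)"] s
  have "((\<lambda>s. \<zeta> (v /\<^sub>R s) / s ^ CARD('n)) has_real_derivative
     (- (1 / s) * ?L ?w * s ^ CARD('n) - \<zeta> ?w * (real CARD('n) * s ^ (CARD('n) - Suc 0)))
       / (s ^ CARD('n) * s ^ CARD('n))) (at s)" by simp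
  moreover have "(- (1 / s) * l * s ^ CARD('n) - z * (real CARD('n) * s ^ (CARD('n) - Suc 0)))
       / (s ^ CARD('n) * s ^ CARD('n)) = - (real CARD('n) * z + l) / s ^ Suc CARD('n)" for l z
  proof -
    \<comment> \<open>The power rule leaves the exponent \<open>CARD('n) - Suc 0\<close>; writing
      the dimension as a successor removes the truncated subtraction.\<close>
    obtain m where m: "CARD('n) = Suc m" using zero_less_card_finite[where 'a='n] gr0_implies_Suc by blast
    show ?thesis unfolding m using s by (simp add: divide_simps) (simp add: algebra_simps)
  qed
  moreover have "div\<zeta> ?w = real CARD('n) * \<zeta> ?w + ?L ?w"
    by (simp only: L div\<zeta>_def sum.distrib sum_constant)
  ultimately show ?thesis by (simp only:)
qed

text \<open>The substitution \<open>z = x - s *\<^sub>R y\<close> links two forms of the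
  convolution: the scale in the kernel, suited to differentiation in \<open>s\<close>, or in the
  argument of \<open>F\<close>, suited to estimates by translation.\<close>

lemma mollification_scaled:
  fixes F :: "real^'n \<Rightarrow> real"
  assumes [measurable]: "F \<in> borel_measurable borel" "h \<in> borel_measurable borel" and s: "s > 0"
  shows "(LINT z|lborel. F z * h ((x - z) /\<^sub>R s)) = s ^ CARD('n) * (LINT y|lborel. F (x - s *\<^sub>R y) * h y)"
  using s by (subst lborel_integral_affine[where t=x and c="-s"]) simp_all

end

section \<open>Mollification and the weak gradient\<close>

text \<open>Both functions are Borel on the whole space, so that expressions such as
  \<open>G (x - s *\<^sub>R y)\<close> are jointly measurable in their variables and Tonelli
  applies.\<close>

locale weak_gradient_pair = mollifier \<zeta> for \<zeta> :: "real^'n \<Rightarrow> real" +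
  fixes \<Omega> :: "(real^'n) set" and F :: "real^'n \<Rightarrow> real" and G :: "real^'n \<Rightarrow> real^'n"
  assumes integrable_F: "integrable lborel F" and integrable_G: "integrable lborel G"
    and weak_gradient: "\<And>\<phi> i. \<phi> \<in> test_functions \<Omega> \<Longrightarrow>
      (LINT z|lborel. F z * frechet_derivative \<phi> (at z) (axis i 1)) = - (LINT z|lborel. G z $ i * \<phi> z)"
begin

lemma measurable_F [measurable]: "F \<in> borel_measurable borel"
  and measurable_G [measurable]: "G \<in> borel_measurable borel"
  using integrable_F integrable_G by auto

lemma integrable_G_component: "integrable lborel (\<lambda>z. G z $ i)"
  using integrable_inner_left[OF integrable_G, of "axis i 1"] by (simp add: inner_axis)

text \<open>Put \<open>w = (x - z) /\<^sub>R s\<close>. Each component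
  \<open>\<zeta> w * w $ i\<close>, as a function of \<open>z\<close>, is a test function supported
  in the given ball. Its derivative in \<open>z $ i\<close> carries the factor
  \<open>- inverse s\<close>, whose sign cancels the one in the weak gradient identity; summing over
  \<open>i\<close> produces the divergence.\<close>

lemma weak_gradient_kernel:
  assumes s: "s > 0" and sub: "ball x (s * (1/2)) \<subseteq> \<Omega>"
  shows "(LINT z|lborel. F z * div\<zeta> ((x - z) /\<^sub>R s)) =
     s * (LINT z|lborel. (G z \<bullet> ((x - z) /\<^sub>R s)) * \<zeta> ((x - z) /\<^sub>R s))"
proof -
  define w where "w z = (x - z) /\<^sub>R s" for z
  have wm [measurable]: "w \<in> borel_measurable borel" unfolding w_def by measurable
  have [measurable]: "(\<lambda>z. D\<zeta> i (w z)) \<in> borel_measurable borel" for i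
    by (rule measurable_compose[OF wm]) (rule measurable_kernel)
  have [measurable]: "(\<lambda>z. w z $ i) \<in> borel_measurable borel" for i
    by (rule measurable_compose[OF wm])
      (intro borel_measurable_continuous_onI continuous_intros)
  have part: "(LINT z|lborel. F z * (\<zeta> (w z) + w z $ i * D\<zeta> i (w z))) =
      s * (LINT z|lborel. G z $ i * (\<zeta> (w z) * w z $ i))" for i
  proof -
    define \<psi> where "\<psi> y = \<zeta> y * (y \<bullet> axis i 1)" for y
    have \<psi>t: "\<psi> \<in> test_functions (ball 0 (1/2))"
      unfolding \<psi>_def by (intro test_functions_times_smooth test_kernel Ck_inner)
    have \<psi>d: "(\<psi> has_derivative (\<lambda>v. \<zeta> y * (v \<bullet> axis i 1) + frechet_derivative \<zeta> (at y) v * (y \<bullet> axis i 1))) (at y)" for y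
      unfolding \<psi>_def by (intro has_derivative_mult has_derivative_kernel derivative_intros)
    have weq: "w = (\<lambda>z. x /\<^sub>R s + (- inverse s) *\<^sub>R z)" by (auto simp: w_def algebra_simps)
    have "((\<lambda>z. \<psi> (w z)) has_derivative (\<lambda>v. frechet_derivative \<psi> (at (w z)) ((- inverse s) *\<^sub>R v))) (at z)" for z
      unfolding weq by (rule frechet_derivative_affine) (use \<psi>d in \<open>blast intro: differentiableI\<close>)
    then have "frechet_derivative (\<lambda>z. \<psi> (w z)) (at z) =
        (\<lambda>v. frechet_derivative \<psi> (at (w z)) ((- inverse s) *\<^sub>R v))" for z
      using frechet_derivative_at by metis
    moreover have "linear (frechet_derivative \<zeta> (at y))" for y
      using has_derivative_kernel has_derivative_linear by blast
    ultimately have fd: "frechet_derivative (\<lambda>z. \<psi> (w z)) (at z) (axis i 1) =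
        (\<zeta> (w z) + w z $ i * D\<zeta> i (w z)) * (- inverse s)" for z
      by (simp add: frechet_derivative_at[OF \<psi>d, symmetric] linear_cmul inner_axis linear_neg algebra_simps)
    have "(\<lambda>z. \<psi> (w z)) \<in> test_functions \<Omega>"
      unfolding w_def by (rule test_functions_affine[OF \<psi>t s sub])
    from weak_gradient[OF this, of i]
    have "(LINT z|lborel. F z * (\<zeta> (w z) + w z $ i * D\<zeta> i (w z)) * (- inverse s)) =
      - (LINT z|lborel. G z $ i * (\<zeta> (w z) * w z $ i))"
      by (simp only: fd) (simp add: \<psi>_def inner_axis mult.assoc)
    then show ?thesis using s by (simp add: field_simps)
  qed
  have iF: "integrable lborel (\<lambda>z. F z * (\<zeta> (w z) + w z $ i * D\<zeta> i (w z)))" for i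
  proof -
    obtain B where B: "\<And>y. \<bar>\<zeta> y * 1\<bar> \<le> B"
      using bounded_product[OF continuous_on_const[of UNIV 1]] by blast
    obtain B' where B': "\<And>y. \<bar>y $ i * D\<zeta> i y\<bar> \<le> B'"
      using bounded_D_product by blast
    show ?thesis
      by (rule integrable_bounded_mult[OF integrable_F, where B="B + B'"])
        (use B B' in \<open>auto intro!: order_trans[OF abs_triangle_ineq] add_mono\<close>)
  qed
  have iG: "integrable lborel (\<lambda>z. G z $ i * (\<zeta> (w z) * w z $ i))" for i
  proof -
    obtain B where B: "\<And>y. \<bar>\<zeta> y * y $ i\<bar> \<le> B"
      using bounded_product[OF continuous_on_component[OF continuous_on_id]] by (auto simp: id_def)
    show ?thesis
      by (rule integrable_bounded_mult[OF integrable_G_component, where B=B]) (use B in auto)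
  qed
  have "(LINT z|lborel. F z * div\<zeta> (w z)) =
      (\<Sum>i\<in>UNIV. LINT z|lborel. F z * (\<zeta> (w z) + w z $ i * D\<zeta> i (w z)))"
    unfolding div\<zeta>_def sum_distrib_left by (rule Bochner_Integration.integral_sum) (rule iF)
  also have "\<dots> = s * (\<Sum>i\<in>UNIV. LINT z|lborel. G z $ i * (\<zeta> (w z) * w z $ i))"
    by (simp add: part sum_distrib_left)
  also have "(\<Sum>i\<in>UNIV. LINT z|lborel. G z $ i * (\<zeta> (w z) * w z $ i)) =
      (LINT z|lborel. (\<Sum>i\<in>UNIV. G z $ i * (\<zeta> (w z) * w z $ i)))"
    by (rule Bochner_Integration.integral_sum[symmetric]) (rule iG)
  also have "(\<lambda>z. (\<Sum>i\<in>UNIV. G z $ i * (\<zeta> (w z) * w z $ i))) = (\<lambda>z. (G z \<bullet> w z) * \<zeta> (w z))"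
    by (simp add: inner_vec_def sum_distrib_left ac_simps)
  finally show ?thesis by (simp add: w_def)
qed

section \<open>The mollification as a function of the scale\<close>

definition moll :: "real \<Rightarrow> real^'n \<Rightarrow> real" where
  "moll s x = (LINT y|lborel. F (x - s *\<^sub>R y) * \<zeta> y)"

text \<open>For smooth \<open>F\<close> with gradient \<open>G\<close> this is minus the derivative
  of \<open>moll s x\<close> in \<open>s\<close>.\<close>

definition gmean :: "real \<Rightarrow> real^'n \<Rightarrow> real" where
  "gmean s x = (LINT y|lborel. (G (x - s *\<^sub>R y) \<bullet> y) * \<zeta> y)"

text \<open>The fundamental theorem of calculus is applied to the smooth kernel in \<open>s\<close>,
  at fixed \<open>z\<close>, instead of to \<open>F\<close>. Fubini then brings the \<open>z\<close>
  integral inside, where the weak gradient identity holds for every scale up to \<epsilon> because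
  the ball of radius \<open>s / 2\<close> stays in \<Omega>.\<close>

lemma moll_diff:
  assumes \<eta>: "0 < \<eta>" "\<eta> \<le> \<epsilon>" and sub: "ball x (\<epsilon> / 2) \<subseteq> \<Omega>"
  shows "moll \<epsilon> x - moll \<eta> x = - (LINT s|lborel. indicator {\<eta>..\<epsilon>} s * gmean s x)"
proof -
  define k where "k s z = \<zeta> ((x - z) /\<^sub>R s) / s ^ CARD('n)" for s z
  define k' where "k' s z = - div\<zeta> ((x - z) /\<^sub>R s) / s ^ Suc CARD('n)" for s z
  have FTC: "(LINT s|lborel. k' s z * indicator {\<eta>..\<epsilon>} s) = k \<epsilon> z - k \<eta> z" for z
  proof (rule integral_FTC_Icc_real[OF \<eta>(2)])
    fix s assume "\<eta> \<le> s" "s \<le> \<epsilon>"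
    then have s: "s > 0" using \<eta> by simp
    show "((\<lambda>s. k s z) has_real_derivative k' s z) (at s)"
      unfolding k_def k'_def by (rule DERIV_rescaled[OF s])
    have "isCont (\<lambda>s. (x - z) /\<^sub>R s) s" using s by (intro continuous_intros) auto
    moreover have "isCont div\<zeta> ((x - z) /\<^sub>R s)"
      using continuous_div_kernel by (simp add: continuous_on_eq_continuous_at)
    ultimately have "isCont (\<lambda>s. div\<zeta> ((x - z) /\<^sub>R s)) s" by (rule isCont_o2)
    then show "isCont (\<lambda>s. k' s z) s"
      unfolding k'_def using s by (intro continuous_intros) auto
  qed
  obtain B where B: "\<And>y. \<bar>div\<zeta> y\<bar> \<le> B" using bounded_div by blast
  have B0: "B \<ge> 0" using B[of 0] by simp
  define H where "H s z = indicator {\<eta>..\<epsilon>} s * (F z * k' s z)" for s z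
  have [measurable]: "case_prod k' \<in> borel_measurable (borel \<Otimes>\<^sub>M borel)"
    unfolding k'_def by measurable
  have [measurable]: "case_prod H \<in> borel_measurable (lborel \<Otimes>\<^sub>M lborel)"
    unfolding H_def by measurable
  \<comment> \<open>Fubini needs a majorant: staying above \<eta> keeps the negative power of
    \<open>s\<close> bounded, so a multiple of \<open>F\<close> on the interval suffices.\<close>
  have Hle: "norm (H s z) \<le> norm (indicator {\<eta>..\<epsilon>} s * (B / \<eta> ^ Suc CARD('n) * F z))" for s z
  proof (cases "s \<in> {\<eta>..\<epsilon>}")
    case True
    then have "\<eta> ^ Suc CARD('n) \<le> s ^ Suc CARD('n)" "s > 0" using \<eta> by (auto intro!: power_mono simp del: power_Suc)
    then have "\<bar>k' s z\<bar> \<le> B / \<eta> ^ Suc CARD('n)"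
      using B[of "(x - z) /\<^sub>R s"] \<eta> B0 unfolding k'_def
      by (auto simp: abs_divide simp del: power_Suc intro!: frac_le)
    then have "\<bar>k' s z\<bar> * \<bar>F z\<bar> \<le> B / \<eta> ^ Suc CARD('n) * \<bar>F z\<bar>" by (intro mult_right_mono) auto
    then show ?thesis using True B0 \<eta> by (simp add: H_def abs_mult mult.commute)
  qed (simp add: H_def)
  have iH: "integrable (lborel \<Otimes>\<^sub>M lborel) (case_prod H)"
  proof (rule Bochner_Integration.integrable_bound)
    show "integrable (lborel \<Otimes>\<^sub>M lborel)
        (\<lambda>(s, z). indicator {\<eta>..\<epsilon>} s * (B / \<eta> ^ Suc CARD('n) * F z) :: real)"
    proof (rule lborel_pair.Fubini_integrable)
      have "integrable lborel
          (\<lambda>s. indicator {\<eta>..\<epsilon>} s * (LINT z|lborel. norm (B / \<eta> ^ Suc CARD('n) * F z)) :: real)"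
        by (intro integrable_mult_left integrable_real_indicator) (auto simp: emeasure_lborel_Icc_eq)
      then show "integrable lborel (\<lambda>s. LINT z|lborel.
          norm (case (s, z) of (s, z) \<Rightarrow> indicator {\<eta>..\<epsilon>} s * (B / \<eta> ^ Suc CARD('n) * F z)))"
        by (simp only: prod.case norm_mult integral_mult_right_zero) (simp del: power_Suc)
    qed (use integrable_F in auto)
  qed (use Hle in auto)
  have ms: "moll s x = (LINT z|lborel. F z * k s z)" if "s > 0" for s
  proof -
    have "(LINT z|lborel. F z * k s z) = (LINT z|lborel. F z * \<zeta> ((x - z) /\<^sub>R s)) / s ^ CARD('n)"
      unfolding k_def by simp
    then show ?thesis
      using that mollification_scaled[of F \<zeta> s x] by (simp add: moll_def)
  qed
  have ik: "integrable lborel (\<lambda>z. F z * k s z)" if "s > 0" for s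
  proof -
    obtain B where B: "\<And>y. \<bar>\<zeta> y * 1\<bar> \<le> B"
      using bounded_product[OF continuous_on_const[of UNIV 1]] by blast
    show ?thesis
      by (rule integrable_bounded_mult[OF integrable_F, where B="B / s ^ CARD('n)"])
        (use B that in \<open>auto simp: k_def abs_divide intro!: divide_right_mono\<close>)
  qed
  have "moll \<epsilon> x - moll \<eta> x = (LINT z|lborel. F z * (k \<epsilon> z - k \<eta> z))"
    using \<eta> ik by (subst (1 2) ms) (auto simp: right_diff_distrib)
  also have "\<dots> = (LINT z|lborel. LINT s|lborel. H s z)"
    by (simp add: H_def ac_simps flip: FTC integral_mult_right_zero)
  also have "\<dots> = (LINT s|lborel. LINT z|lborel. H s z)"
    by (rule lborel_pair.Fubini_integral[OF iH])
  also have "(\<lambda>s. LINT z|lborel. H s z) = (\<lambda>s. - (indicator {\<eta>..\<epsilon>} s * gmean s x))"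
  proof
    fix s
    show "(LINT z|lborel. H s z) = - (indicator {\<eta>..\<epsilon>} s * gmean s x)"
    proof (cases "s \<in> {\<eta>..\<epsilon>}")
      case True
      then have s: "s > 0" "ball x (s * (1/2)) \<subseteq> \<Omega>" using \<eta> sub by (auto simp: subset_iff)
      \<comment> \<open>All powers of \<open>s\<close> cancel: \<open>1 / s ^ Suc CARD('n)\<close>
        from the kernel, \<open>s\<close> from the weak gradient identity and
        \<open>s ^ CARD('n)\<close> from the change of variables.\<close>
      have "(LINT z|lborel. H s z) = (LINT z|lborel. F z * div\<zeta> ((x - z) /\<^sub>R s)) * (- (1 / s ^ Suc CARD('n)))"
        unfolding integral_mult_left_zero[symmetric] using True by (simp add: H_def k'_def)
      also have "(LINT z|lborel. F z * div\<zeta> ((x - z) /\<^sub>R s)) =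
          s * (LINT z|lborel. (G z \<bullet> ((x - z) /\<^sub>R s)) * \<zeta> ((x - z) /\<^sub>R s))"
        by (rule weak_gradient_kernel[OF s])
      also have "(LINT z|lborel. (G z \<bullet> ((x - z) /\<^sub>R s)) * \<zeta> ((x - z) /\<^sub>R s)) = s ^ CARD('n) * gmean s x"
        unfolding gmean_def using s(1)
        by (subst lborel_integral_affine[where t=x and c="-s"]) simp_all
      finally show ?thesis using s(1) True by simp
    qed (simp add: H_def)
  qed
  finally show ?thesis by simp
qed

section \<open>Weighted square estimates, uniform in the smaller scale\<close>

lemma nn_integral_abs_kernel: "(\<integral>\<^sup>+y. ennreal \<bar>\<zeta> y\<bar> \<partial>lborel) = ennreal \<zeta>norm"
  using integrable_kernel by (intro nn_integral_eq_integral) auto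

text \<open>Cauchy-Schwarz for the measure with density \<open>\<bar>\<zeta> y\<bar>\<close> on the
  scales from 0 to \<epsilon>, whose total mass is \<open>\<epsilon> * \<zeta>norm\<close>.
  Extending the scales from \<eta> down to 0 removes \<eta> from the right-hand side.\<close>

lemma moll_diff_square_le:
  assumes \<eta>: "0 < \<eta>" "\<eta> \<le> \<epsilon>" and sub: "ball x (\<epsilon> / 2) \<subseteq> \<Omega>"
  shows "ennreal ((moll \<epsilon> x - moll \<eta> x)\<^sup>2) \<le> ennreal (\<epsilon> * \<zeta>norm) *
    (\<integral>\<^sup>+s. \<integral>\<^sup>+y. ennreal (indicator {0..\<epsilon>} s * \<bar>\<zeta> y\<bar> * (norm (G (x - s *\<^sub>R y)))\<^sup>2) \<partial>lborel \<partial>lborel)"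
proof -
  \<comment> \<open>The square root of the density: \<open>a * b\<close> is then the density times
    the norm of \<open>G\<close>, while the squares of \<open>a\<close> and \<open>b\<close> are the
    density and the density times the squared norm.\<close>
  define a where "a p = ennreal (sqrt (indicator {0..\<epsilon>} (fst p) * \<bar>\<zeta> (snd p)\<bar>))" for p
  define b where "b p = a p * ennreal (norm (G (x - fst p *\<^sub>R snd p)))" for p
  have [measurable]: "a \<in> borel_measurable (lborel \<Otimes>\<^sub>M lborel)" "b \<in> borel_measurable (lborel \<Otimes>\<^sub>M lborel)"
    unfolding a_def b_def by measurable
  have a2: "a (s, y) * a (s, y) = ennreal (indicator {0..\<epsilon>} s * \<bar>\<zeta> y\<bar>)" for s y
    by (simp add: a_def ennreal_mult[symmetric])
  have "ennreal \<bar>moll \<epsilon> x - moll \<eta> x\<bar> \<le> (\<integral>\<^sup>+s. ennreal (norm (indicator {\<eta>..\<epsilon>} s * gmean s x)) \<partial>lborel)"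
    unfolding moll_diff[OF assms] abs_minus_cancel
    using ennreal_norm_integral_le[of lborel "\<lambda>s. indicator {\<eta>..\<epsilon>} s * gmean s x"]
    by (simp only: real_norm_def)
  also have "\<dots> \<le> (\<integral>\<^sup>+s. \<integral>\<^sup>+y. a (s, y) * b (s, y) \<partial>lborel \<partial>lborel)"
  proof (rule nn_integral_mono)
    fix s
    show "ennreal (norm (indicator {\<eta>..\<epsilon>} s * gmean s x)) \<le> (\<integral>\<^sup>+y. a (s, y) * b (s, y) \<partial>lborel)"
    proof (cases "s \<in> {\<eta>..\<epsilon>}")
      case True
      have "ennreal \<bar>gmean s x\<bar> \<le> (\<integral>\<^sup>+y. ennreal (norm ((G (x - s *\<^sub>R y) \<bullet> y) * \<zeta> y)) \<partial>lborel)"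
        unfolding gmean_def real_norm_def[symmetric] by (rule ennreal_norm_integral_le)
      also have "\<dots> \<le> (\<integral>\<^sup>+y. a (s, y) * b (s, y) \<partial>lborel)"
      proof (rule nn_integral_mono)
        fix y
        \<comment> \<open>On the support of the kernel \<open>norm y\<close> is below 1/2, so the
          factor \<open>y\<close> is bounded by 1.\<close>
        have "\<bar>(G (x - s *\<^sub>R y) \<bullet> y) * \<zeta> y\<bar> \<le> norm (G (x - s *\<^sub>R y)) * \<bar>\<zeta> y\<bar>"
        proof (cases "norm y \<ge> 1/2")
          case False
          then have "\<bar>G (x - s *\<^sub>R y) \<bullet> y\<bar> \<le> norm (G (x - s *\<^sub>R y)) * 1"
            by (intro order_trans[OF Cauchy_Schwarz_ineq2] mult_left_mono) auto
          then show ?thesis unfolding abs_mult by (intro mult_right_mono) auto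
        qed (simp add: kernel_zero_outside)
        then show "ennreal (norm ((G (x - s *\<^sub>R y) \<bullet> y) * \<zeta> y)) \<le> a (s, y) * b (s, y)"
          using True \<eta> by (auto simp: b_def mult.assoc[symmetric] a2 ennreal_mult[symmetric] mult.commute intro!: ennreal_leI)
      qed
      finally show ?thesis using True by simp
    qed simp
  qed
  also have "\<dots> = (\<integral>\<^sup>+p. a p * b p \<partial>(lborel \<Otimes>\<^sub>M lborel))"
    by (rule lborel.nn_integral_fst) measurable
  finally have "(ennreal \<bar>moll \<epsilon> x - moll \<eta> x\<bar>)\<^sup>2 \<le> (\<integral>\<^sup>+p. a p * b p \<partial>(lborel \<Otimes>\<^sub>M lborel))\<^sup>2"
    by (rule power_mono) simp
  also have "\<dots> \<le> (\<integral>\<^sup>+p. (a p)\<^sup>2 \<partial>(lborel \<Otimes>\<^sub>M lborel)) * (\<integral>\<^sup>+p. (b p)\<^sup>2 \<partial>(lborel \<Otimes>\<^sub>M lborel))"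
    by (rule Cauchy_Schwarz_nn_integral) measurable
  also have "(\<integral>\<^sup>+p. (a p)\<^sup>2 \<partial>(lborel \<Otimes>\<^sub>M lborel)) = (\<integral>\<^sup>+s. \<integral>\<^sup>+y. (a (s, y))\<^sup>2 \<partial>lborel \<partial>lborel)"
    by (rule lborel.nn_integral_fst[symmetric]) measurable
  also have "\<dots> = (\<integral>\<^sup>+s. indicator {0..\<epsilon>} s * ennreal \<zeta>norm \<partial>lborel)"
    by (simp add: power2_eq_square a2 ennreal_mult' nn_integral_cmult nn_integral_abs_kernel ennreal_indicator)
  also have "\<dots> = ennreal (\<epsilon> * \<zeta>norm)"
    using \<eta> by (subst nn_integral_multc) (auto simp: ennreal_mult')
  also have "(\<integral>\<^sup>+p. (b p)\<^sup>2 \<partial>(lborel \<Otimes>\<^sub>M lborel)) = (\<integral>\<^sup>+s. \<integral>\<^sup>+y. (b (s, y))\<^sup>2 \<partial>lborel \<partial>lborel)"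
    by (rule lborel.nn_integral_fst[symmetric]) measurable
  also have "(\<lambda>s. \<integral>\<^sup>+y. (b (s, y))\<^sup>2 \<partial>lborel) =
    (\<lambda>s. \<integral>\<^sup>+y. ennreal (indicator {0..\<epsilon>} s * \<bar>\<zeta> y\<bar> * (norm (G (x - s *\<^sub>R y)))\<^sup>2) \<partial>lborel)"
    by (intro ext nn_integral_cong)
      (simp add: b_def power_mult_distrib power2_eq_square[of "a _"] a2 ennreal_power ennreal_mult[symmetric])
  finally show ?thesis by (simp add: ennreal_power)
qed

text \<open>Tonelli puts the \<open>x\<close> integral innermost, at a fixed shift
  \<open>h = s *\<^sub>R y\<close> of length at most \<open>\<epsilon> / 2\<close>. There
  \<open>WV\<close> trades \<open>W x\<close> for twice \<open>V (x - h)\<close>, and translation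
  invariance removes the shift. Integrating the density once more gives the second factor
  \<open>\<epsilon> * \<zeta>norm\<close>.\<close>

lemma weighted_moll_diff_le:
  assumes \<eta>: "0 < \<eta>" "\<eta> \<le> \<epsilon>"
    and [measurable]: "W \<in> borel_measurable borel" "V \<in> borel_measurable borel"
    and W0: "\<And>x. W x \<ge> 0" and V0: "\<And>x. V x \<ge> 0"
    and sub: "\<And>x. W x \<noteq> 0 \<Longrightarrow> ball x (\<epsilon> / 2) \<subseteq> \<Omega>"
    and WV: "\<And>x h. norm h \<le> \<epsilon> / 2 \<Longrightarrow> W x \<le> 2 * V (x - h)"
  shows "(\<integral>\<^sup>+x. ennreal (W x * (moll \<epsilon> x - moll \<eta> x)\<^sup>2) \<partial>lborel) \<le>
    ennreal (2 * (\<epsilon> * \<zeta>norm)\<^sup>2) * (\<integral>\<^sup>+z. ennreal (V z * (norm (G z))\<^sup>2) \<partial>lborel)"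
proof -
  let ?A = "\<integral>\<^sup>+z. ennreal (V z * (norm (G z))\<^sup>2) \<partial>lborel"
  define q where "q x s y = ennreal (indicator {0..\<epsilon>} s * \<bar>\<zeta> y\<bar>) * ennreal (W x * (norm (G (x - s *\<^sub>R y)))\<^sup>2)" for x s y
  have inner: "(\<integral>\<^sup>+x. ennreal (W x * (norm (G (x - h)))\<^sup>2) \<partial>lborel) \<le> 2 * ?A" if h: "norm h \<le> \<epsilon> / 2" for h
  proof -
    have "(\<integral>\<^sup>+x. ennreal (W x * (norm (G (x - h)))\<^sup>2) \<partial>lborel)
        \<le> (\<integral>\<^sup>+x. 2 * ennreal (V (x - h) * (norm (G (x - h)))\<^sup>2) \<partial>lborel)"
    proof (rule nn_integral_mono)
      fix x
      have "W x * (norm (G (x - h)))\<^sup>2 \<le> 2 * V (x - h) * (norm (G (x - h)))\<^sup>2"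
        by (intro mult_right_mono WV h) auto
      then have "ennreal (W x * (norm (G (x - h)))\<^sup>2) \<le> ennreal (2 * (V (x - h) * (norm (G (x - h)))\<^sup>2))"
        by (intro ennreal_leI) (simp add: mult.assoc)
      then show "ennreal (W x * (norm (G (x - h)))\<^sup>2) \<le> 2 * ennreal (V (x - h) * (norm (G (x - h)))\<^sup>2)"
        by (simp add: ennreal_mult')
    qed
    also have "\<dots> = 2 * (\<integral>\<^sup>+x. ennreal (V (x - h) * (norm (G (x - h)))\<^sup>2) \<partial>lborel)"
      by (rule nn_integral_cmult) measurable
    also have "(\<integral>\<^sup>+x. ennreal (V (x - h) * (norm (G (x - h)))\<^sup>2) \<partial>lborel) = ?A"
      using lborel_nn_integral_affine[of "\<lambda>z. ennreal (V z * (norm (G z))\<^sup>2)" 1 "-h"] by simp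
    finally show ?thesis .
  qed
  have "(\<integral>\<^sup>+x. ennreal (W x * (moll \<epsilon> x - moll \<eta> x)\<^sup>2) \<partial>lborel) \<le>
      (\<integral>\<^sup>+x. ennreal (\<epsilon> * \<zeta>norm) * (\<integral>\<^sup>+s. \<integral>\<^sup>+y. q x s y \<partial>lborel \<partial>lborel) \<partial>lborel)"
  proof (rule nn_integral_mono)
    fix x
    show "ennreal (W x * (moll \<epsilon> x - moll \<eta> x)\<^sup>2) \<le>
      ennreal (\<epsilon> * \<zeta>norm) * (\<integral>\<^sup>+s. \<integral>\<^sup>+y. q x s y \<partial>lborel \<partial>lborel)"
    \<comment> \<open>The pointwise estimate requires the ball about \<open>x\<close> to lie in
      \<Omega>, which is known only where \<open>W\<close> is nonzero; elsewhere the left-hand side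
      is 0.\<close>
    proof (cases "W x = 0")
      case False
      have "ennreal (W x * (moll \<epsilon> x - moll \<eta> x)\<^sup>2) = ennreal (W x) * ennreal ((moll \<epsilon> x - moll \<eta> x)\<^sup>2)"
        by (rule ennreal_mult') (rule W0)
      also have "\<dots> \<le> ennreal (W x) * (ennreal (\<epsilon> * \<zeta>norm) *
          (\<integral>\<^sup>+s. \<integral>\<^sup>+y. ennreal (indicator {0..\<epsilon>} s * \<bar>\<zeta> y\<bar> * (norm (G (x - s *\<^sub>R y)))\<^sup>2) \<partial>lborel \<partial>lborel))"
        by (intro mult_left_mono moll_diff_square_le \<eta> sub False) auto
      also have "\<dots> = ennreal (\<epsilon> * \<zeta>norm) *
          (\<integral>\<^sup>+s. \<integral>\<^sup>+y. ennreal (W x) * ennreal (indicator {0..\<epsilon>} s * \<bar>\<zeta> y\<bar> * (norm (G (x - s *\<^sub>R y)))\<^sup>2) \<partial>lborel \<partial>lborel)"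
        by (simp add: nn_integral_cmult mult.left_commute)
      also have "\<dots> = ennreal (\<epsilon> * \<zeta>norm) * (\<integral>\<^sup>+s. \<integral>\<^sup>+y. q x s y \<partial>lborel \<partial>lborel)"
        by (simp add: q_def ennreal_mult[symmetric] W0 ac_simps)
      finally show ?thesis .
    qed simp
  qed
  also have "\<dots> = ennreal (\<epsilon> * \<zeta>norm) * (\<integral>\<^sup>+x. \<integral>\<^sup>+s. \<integral>\<^sup>+y. q x s y \<partial>lborel \<partial>lborel \<partial>lborel)"
    unfolding q_def by (rule nn_integral_cmult) measurable
  finally have 1: "(\<integral>\<^sup>+x. ennreal (W x * (moll \<epsilon> x - moll \<eta> x)\<^sup>2) \<partial>lborel) \<le>
      ennreal (\<epsilon> * \<zeta>norm) * (\<integral>\<^sup>+x. \<integral>\<^sup>+s. \<integral>\<^sup>+y. q x s y \<partial>lborel \<partial>lborel \<partial>lborel)" .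
  have "(\<integral>\<^sup>+x. \<integral>\<^sup>+s. \<integral>\<^sup>+y. q x s y \<partial>lborel \<partial>lborel \<partial>lborel) =
      (\<integral>\<^sup>+s. \<integral>\<^sup>+x. \<integral>\<^sup>+y. q x s y \<partial>lborel \<partial>lborel \<partial>lborel)"
    unfolding q_def by (rule lborel_pair.Fubini') measurable
  also have "\<dots> = (\<integral>\<^sup>+s. \<integral>\<^sup>+y. \<integral>\<^sup>+x. q x s y \<partial>lborel \<partial>lborel \<partial>lborel)"
    unfolding q_def by (intro nn_integral_cong lborel_pair.Fubini') measurable
  also have "\<dots> \<le> (\<integral>\<^sup>+s. \<integral>\<^sup>+y. ennreal (indicator {0..\<epsilon>} s * \<bar>\<zeta> y\<bar>) * (2 * ?A) \<partial>lborel \<partial>lborel)"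
  proof (intro nn_integral_mono)
    fix s y
    have "(\<integral>\<^sup>+x. q x s y \<partial>lborel) =
        ennreal (indicator {0..\<epsilon>} s * \<bar>\<zeta> y\<bar>) * (\<integral>\<^sup>+x. ennreal (W x * (norm (G (x - s *\<^sub>R y)))\<^sup>2) \<partial>lborel)"
      unfolding q_def by (rule nn_integral_cmult) measurable
    also have "\<dots> \<le> ennreal (indicator {0..\<epsilon>} s * \<bar>\<zeta> y\<bar>) * (2 * ?A)"
    proof (cases "s \<in> {0..\<epsilon>} \<and> norm y < 1/2")
      case True
      then have "norm (s *\<^sub>R y) \<le> \<epsilon> / 2" using mult_mono[of s \<epsilon> "norm y" "1/2"] by auto
      then show ?thesis by (intro mult_left_mono inner) auto
    qed (use kernel_zero_outside[of y] in \<open>auto simp: not_less\<close>)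
    finally show "(\<integral>\<^sup>+x. q x s y \<partial>lborel) \<le> ennreal (indicator {0..\<epsilon>} s * \<bar>\<zeta> y\<bar>) * (2 * ?A)" .
  qed
  also have "\<dots> = (\<integral>\<^sup>+s. indicator {0..\<epsilon>} s * ennreal \<zeta>norm * (2 * ?A) \<partial>lborel)"
    by (simp add: nn_integral_multc nn_integral_cmult ennreal_mult' nn_integral_abs_kernel ennreal_indicator)
  also have "\<dots> = ennreal (\<epsilon> * \<zeta>norm) * (2 * ?A)"
    using \<eta> by (simp add: nn_integral_multc ennreal_mult' mult.assoc)
  finally have "ennreal (\<epsilon> * \<zeta>norm) * (\<integral>\<^sup>+x. \<integral>\<^sup>+s. \<integral>\<^sup>+y. q x s y \<partial>lborel \<partial>lborel \<partial>lborel) \<le>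
      ennreal (\<epsilon> * \<zeta>norm) * (ennreal (\<epsilon> * \<zeta>norm) * (2 * ?A))"
    by (rule mult_left_mono) simp
  from order_trans[OF 1 this] show ?thesis
    using \<eta> by (simp add: ennreal_mult' power2_eq_square ac_simps)
qed

end

section \<open>Convergence of the mollification\<close>

context weak_gradient_pair
begin

lemma integrable_moll_kernel:
  assumes "s > 0"
  shows "integrable lborel (\<lambda>y. F (x - s *\<^sub>R y) * \<zeta> y)"
proof -
  obtain B where "\<And>y. \<bar>\<zeta> y * 1\<bar> \<le> B"
    using bounded_product[OF continuous_on_const[of UNIV 1]] by blast
  moreover have "integrable lborel (\<lambda>y. F (x - s *\<^sub>R y))"
    using lborel_integrable_affine_iff[of F "-s" x] integrable_F assms by simp
  ultimately show ?thesis by (intro integrable_bounded_mult) auto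
qed

lemma measurable_mollification [measurable]: "moll s \<in> borel_measurable borel"
proof -
  have "(\<lambda>x. LINT y|lborel. F (x - s *\<^sub>R y) * \<zeta> y) \<in> borel_measurable lborel"
    by measurable
  then show ?thesis by (simp add: moll_def[abs_def])
qed

text \<open>As the kernel has integral 1, \<open>moll s x - F x\<close> is the kernel average of
  \<open>F (x - s *\<^sub>R y) - F x\<close>; then Tonelli. The left side is a nonnegative integral
  because integrability of the difference is itself deduced from this bound.\<close>

lemma moll_nn_L1_le:
  assumes s: "s > 0"
  shows "(\<integral>\<^sup>+x. ennreal \<bar>moll s x - F x\<bar> \<partial>lborel) \<le>
    ennreal (LINT y|lborel. \<bar>\<zeta> y\<bar> * (LINT x|lborel. \<bar>F (x - s *\<^sub>R y) - F x\<bar>))"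
proof -
  have "(\<integral>\<^sup>+x. ennreal \<bar>moll s x - F x\<bar> \<partial>lborel) \<le>
      (\<integral>\<^sup>+x. \<integral>\<^sup>+y. ennreal (\<bar>\<zeta> y\<bar> * \<bar>F (x - s *\<^sub>R y) - F x\<bar>) \<partial>lborel \<partial>lborel)"
  proof (rule nn_integral_mono)
    fix x
    have "moll s x - F x = (LINT y|lborel. \<zeta> y * (F (x - s *\<^sub>R y) - F x))"
      using integrable_moll_kernel[OF s, of x] integrable_kernel integral_kernel
      by (simp add: moll_def right_diff_distrib mult.commute)
    then show "ennreal \<bar>moll s x - F x\<bar> \<le> (\<integral>\<^sup>+y. ennreal (\<bar>\<zeta> y\<bar> * \<bar>F (x - s *\<^sub>R y) - F x\<bar>) \<partial>lborel)"
      using ennreal_norm_integral_le[of lborel "\<lambda>y. \<zeta> y * (F (x - s *\<^sub>R y) - F x)"]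
      by (simp add: abs_mult)
  qed
  also have "\<dots> = (\<integral>\<^sup>+y. \<integral>\<^sup>+x. ennreal (\<bar>\<zeta> y\<bar> * \<bar>F (x - s *\<^sub>R y) - F x\<bar>) \<partial>lborel \<partial>lborel)"
    by (rule lborel_pair.Fubini') measurable
  also have "\<dots> = (\<integral>\<^sup>+y. ennreal (\<bar>\<zeta> y\<bar> * (LINT x|lborel. \<bar>F (x - s *\<^sub>R y) - F x\<bar>)) \<partial>lborel)"
  proof (rule nn_integral_cong)
    fix y
    have "(\<integral>\<^sup>+x. ennreal (\<bar>\<zeta> y\<bar> * \<bar>F (x - s *\<^sub>R y) - F x\<bar>) \<partial>lborel) =
        ennreal (LINT x|lborel. \<bar>\<zeta> y\<bar> * \<bar>F (x - s *\<^sub>R y) - F x\<bar>)"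
      using lborel_integrable_translate[OF integrable_F, of "s *\<^sub>R y"] integrable_F by (intro nn_integral_eq_integral) auto
    then show "(\<integral>\<^sup>+x. ennreal (\<bar>\<zeta> y\<bar> * \<bar>F (x - s *\<^sub>R y) - F x\<bar>) \<partial>lborel) =
        ennreal (\<bar>\<zeta> y\<bar> * (LINT x|lborel. \<bar>F (x - s *\<^sub>R y) - F x\<bar>))" by simp
  qed
  also have "\<dots> = ennreal (LINT y|lborel. \<bar>\<zeta> y\<bar> * (LINT x|lborel. \<bar>F (x - s *\<^sub>R y) - F x\<bar>))"
  proof (rule nn_integral_eq_integral)
    show "integrable lborel (\<lambda>y. \<bar>\<zeta> y\<bar> * (LINT x|lborel. \<bar>F (x - s *\<^sub>R y) - F x\<bar>))"
      by (rule integrable_bounded_mult[where B="2 * (LINT x|lborel. \<bar>F x\<bar>)"])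
        (use integrable_kernel integral_abs_translate_diff_le[OF integrable_F] in auto)
  qed auto
  finally show ?thesis .
qed

text \<open>For each \<open>y\<close> the translation error vanishes in the limit and never exceeds
  twice the L1 norm of \<open>F\<close>, so dominated convergence applies in
  \<open>y\<close>.\<close>

lemma moll_L1_tendsto:
  assumes s: "\<And>n. s n > 0" "s \<longlonglongrightarrow> 0"
  shows "integrable lborel (\<lambda>x. moll (s n) x - F x)"
    and "(\<lambda>n. LINT x|lborel. \<bar>moll (s n) x - F x\<bar>) \<longlonglongrightarrow> 0"
proof -
  show int: "integrable lborel (\<lambda>x. moll (s n) x - F x)" for n
    using moll_nn_L1_le[OF s(1)[of n]] by (intro integrableI_bounded) (auto simp: order_le_less_trans)
  define b where "b n = (LINT y|lborel. \<bar>\<zeta> y\<bar> * (LINT x|lborel. \<bar>F (x - s n *\<^sub>R y) - F x\<bar>))" for n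
  have "b \<longlonglongrightarrow> (LINT y::real^'n|lborel. 0)"
    unfolding b_def
  proof (rule integral_dominated_convergence[where w="\<lambda>y. \<bar>\<zeta> y\<bar> * (2 * (LINT x|lborel. \<bar>F x\<bar>))"])
    have "(\<lambda>n. \<bar>\<zeta> y\<bar> * (LINT x|lborel. \<bar>F (x - s n *\<^sub>R y) - F x\<bar>)) \<longlonglongrightarrow> \<bar>\<zeta> y\<bar> * 0" for y
      using tendsto_scaleR[OF s(2) tendsto_const[of y]]
      by (intro tendsto_mult tendsto_const translation_tendsto_L1 integrable_F) simp
    then show "AE y in lborel. (\<lambda>n. \<bar>\<zeta> y\<bar> * (LINT x|lborel. \<bar>F (x - s n *\<^sub>R y) - F x\<bar>)) \<longlonglongrightarrow> 0"
      by simp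
    show "AE y in lborel. norm (\<bar>\<zeta> y\<bar> * (LINT x|lborel. \<bar>F (x - s n *\<^sub>R y) - F x\<bar>))
        \<le> \<bar>\<zeta> y\<bar> * (2 * (LINT x|lborel. \<bar>F x\<bar>))" for n
      using integral_abs_translate_diff_le[OF integrable_F] by (auto simp: abs_mult intro!: mult_left_mono)
  qed (use integrable_kernel in auto)
  then have b: "b \<longlonglongrightarrow> 0" by simp
  have "(LINT x|lborel. \<bar>moll (s n) x - F x\<bar>) \<le> b n" for n
  proof -
    have "ennreal (LINT x|lborel. \<bar>moll (s n) x - F x\<bar>) = (\<integral>\<^sup>+x. ennreal \<bar>moll (s n) x - F x\<bar> \<partial>lborel)"
      using int[of n] by (intro nn_integral_eq_integral[symmetric]) auto
    also have "\<dots> \<le> ennreal (b n)" unfolding b_def by (rule moll_nn_L1_le[OF s(1)])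
    finally show ?thesis by (simp add: b_def integral_nonneg_AE)
  qed
  then show "(\<lambda>n. LINT x|lborel. \<bar>moll (s n) x - F x\<bar>) \<longlonglongrightarrow> 0"
    by (intro tendsto_sandwich[OF _ _ tendsto_const b]) auto
qed

lemma weighted_moll_error_le:
  assumes \<epsilon>: "\<epsilon> > 0"
    and [measurable]: "W \<in> borel_measurable borel" "V \<in> borel_measurable borel"
    and W0: "\<And>x. W x \<ge> 0" and V0: "\<And>x. V x \<ge> 0"
    and sub: "\<And>x. W x \<noteq> 0 \<Longrightarrow> ball x (\<epsilon> / 2) \<subseteq> \<Omega>"
    and WV: "\<And>x h. norm h \<le> \<epsilon> / 2 \<Longrightarrow> W x \<le> 2 * V (x - h)"
  shows "(\<integral>\<^sup>+x. ennreal (W x * (F x - moll \<epsilon> x)\<^sup>2) \<partial>lborel) \<le>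
    ennreal (2 * (\<epsilon> * \<zeta>norm)\<^sup>2) * (\<integral>\<^sup>+z. ennreal (V z * (norm (G z))\<^sup>2) \<partial>lborel)"
proof -
  \<comment> \<open>These scales tend to 0 while staying positive and at most \<epsilon>, as the
    estimate between two scales requires.\<close>
  define s where "s n = \<epsilon> * inverse (real (Suc n))" for n
  have s: "s n > 0" "s n \<le> \<epsilon>" for n using \<epsilon> by (auto simp: s_def field_simps)
  have s0: "s \<longlonglongrightarrow> 0" unfolding s_def by (rule tendsto_mult_right_zero[OF LIMSEQ_inverse_real_of_nat])
  from tendsto_L1_AE_subseq[OF moll_L1_tendsto(1)[OF s(1) s0], folded real_norm_def, OF moll_L1_tendsto(2)[OF s(1) s0, folded real_norm_def]]
  obtain r where r: "AE x in lborel. (\<lambda>n. moll (s (r n)) x - F x) \<longlonglongrightarrow> 0" by blast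
  have "(\<integral>\<^sup>+x. ennreal (W x * (F x - moll \<epsilon> x)\<^sup>2) \<partial>lborel) =
      (\<integral>\<^sup>+x. liminf (\<lambda>n. ennreal (W x * (moll \<epsilon> x - moll (s (r n)) x)\<^sup>2)) \<partial>lborel)"
  proof (rule nn_integral_cong_AE, use r in eventually_elim)
    case (elim x)
    have "(\<lambda>n. W x * (moll \<epsilon> x - F x - (moll (s (r n)) x - F x))\<^sup>2) \<longlonglongrightarrow> W x * (moll \<epsilon> x - F x - 0)\<^sup>2"
      by (intro tendsto_intros elim)
    then have "(\<lambda>n. ennreal (W x * (moll \<epsilon> x - moll (s (r n)) x)\<^sup>2)) \<longlonglongrightarrow> ennreal (W x * (F x - moll \<epsilon> x)\<^sup>2)"
      by (intro tendsto_ennrealI) (simp add: power2_commute)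
    then show ?case by (rule lim_imp_Liminf[symmetric, rotated]) simp
  qed
  also have "\<dots> \<le> liminf (\<lambda>n. \<integral>\<^sup>+x. ennreal (W x * (moll \<epsilon> x - moll (s (r n)) x)\<^sup>2) \<partial>lborel)"
    by (rule nn_integral_liminf) measurable
  also have "\<dots> \<le> liminf (\<lambda>n::nat. ennreal (2 * (\<epsilon> * \<zeta>norm)\<^sup>2) * (\<integral>\<^sup>+z. ennreal (V z * (norm (G z))\<^sup>2) \<partial>lborel))"
    by (intro Liminf_mono always_eventually allI weighted_moll_diff_le s assms)
  finally show ?thesis by (simp add: Liminf_const)
qed

end

section \<open>Lebesgue and Borel measurable representatives\<close>

text \<open>The real-valued case is applied to each coordinate; the finitely many exceptional null
  sets are merged and the vector is reassembled from its coordinates.\<close>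

lemma lebesgue_ex_borel_representative:
  fixes f :: "'a::euclidean_space \<Rightarrow> 'b::euclidean_space"
  assumes f: "f \<in> borel_measurable lebesgue"
  obtains f' where "f' \<in> borel_measurable borel" "AE x in lborel. f' x = f x"
proof -
  have "\<exists>h\<in>borel_measurable lborel. AE x in lborel. f x \<bullet> b = h x" for b
    using f by (intro completion_ex_borel_measurable_real) auto
  then obtain h where h: "\<And>b. h b \<in> borel_measurable borel" "\<And>b. AE x in lborel. f x \<bullet> b = h b x"
    by (simp add: Bex_def) metis
  have "AE x in lborel. \<forall>b\<in>Basis. f x \<bullet> b = h b x"
    by (rule AE_finite_allI) (use h in auto)
  then have "AE x in lborel. (\<Sum>b\<in>Basis. h b x *\<^sub>R b) = f x"
    by eventually_elim (metis (no_types, lifting) euclidean_representation sum.cong)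
  moreover have "(\<lambda>x. \<Sum>b\<in>Basis. h b x *\<^sub>R b) \<in> borel_measurable borel"
    using h(1) by measurable
  ultimately show thesis using that by blast
qed

text \<open>Completeness of \<open>lebesgue\<close> makes \<open>f\<close> measurable once it agrees
  almost everywhere with a Borel function.\<close>

lemma lebesgue_integral_borel_version:
  fixes f g :: "'a::euclidean_space \<Rightarrow> 'b::euclidean_space"
  assumes g: "g \<in> borel_measurable borel" and eq: "AE x in lborel. g x = f x"
  shows "(LINT x|lebesgue. f x) = (LINT x|lborel. g x)"
    and "integrable lebesgue f \<longleftrightarrow> integrable lborel g"
proof -
  have gm: "g \<in> borel_measurable lebesgue" using g by (simp add: measurable_completion)
  have eq': "AE x in lebesgue. g x = f x" using eq by (simp add: AE_completion_iff)
  have fm: "f \<in> borel_measurable lebesgue" by (rule borel_measurable_AE[OF gm eq'])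
  show "(LINT x|lebesgue. f x) = (LINT x|lborel. g x)"
    using integral_cong_AE[OF gm fm eq'] g by (simp add: integral_completion)
  show "integrable lebesgue f \<longleftrightarrow> integrable lborel g"
    using integrable_cong_AE[OF gm fm eq'] g by (simp add: integrable_completion)
qed

lemma integral_le_nn_integral_bound:
  fixes f :: "'a \<Rightarrow> real"
  assumes f: "f \<in> borel_measurable M" "\<And>x. 0 \<le> f x" and B: "(\<integral>\<^sup>+x. ennreal (f x) \<partial>M) \<le> ennreal B" "0 \<le> B"
  shows "(LINT x|M. f x) \<le> B"
  using f B by (subst integral_eq_nn_integral) (auto intro: enn2real_leI)

lemma L2_bounded_borel_representative:
  fixes f :: "'a::euclidean_space \<Rightarrow> 'b::euclidean_space"
  assumes f: "f \<in> L2 \<Omega>" and \<Omega>: "open \<Omega>" "bounded \<Omega>"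
  obtains F where "F \<in> borel_measurable borel" "AE x in lborel. F x = indicator \<Omega> x *\<^sub>R f x"
    "integrable lborel F" "integrable lborel (\<lambda>x. (norm (F x))\<^sup>2)"
proof -
  have "(\<lambda>x. indicator \<Omega> x *\<^sub>R f x) \<in> borel_measurable lebesgue"
    using f by (simp add: L2_def set_borel_measurable_def)
  then obtain F where F [measurable]: "F \<in> borel_measurable borel" and AE: "AE x in lborel. F x = indicator \<Omega> x *\<^sub>R f x"
    by (rule lebesgue_ex_borel_representative)
  have "AE x in lborel. (norm (F x))\<^sup>2 = indicator \<Omega> x *\<^sub>R (norm (f x))\<^sup>2"
    using AE by eventually_elim (auto simp: indicator_def)
  from lebesgue_integral_borel_version(2)[OF _ this] have sq: "integrable lborel (\<lambda>x. (norm (F x))\<^sup>2)"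
    using f by (simp add: L2_def set_integrable_def)
  have iF: "integrable lborel F"
  proof (rule Bochner_Integration.integrable_bound)
    show "integrable lborel (\<lambda>x. indicator \<Omega> x + (norm (F x))\<^sup>2 :: real)"
      using \<Omega> emeasure_bounded_finite[OF \<Omega>(2)]
      by (intro Bochner_Integration.integrable_add integrable_real_indicator sq) auto
    show "AE x in lborel. norm (F x) \<le> norm (indicator \<Omega> x + (norm (F x))\<^sup>2 :: real)"
      using AE
    proof eventually_elim
      case (elim x)
      show ?case
      proof (cases "x \<in> \<Omega>")
        case True
        \<comment> \<open>Expanding the square bounds \<open>norm (F x)\<close> by its square plus
          1/4; since \<Omega> has finite measure, square integrability thus implies
          integrability.\<close>
        have "0 \<le> (norm (F x) - 1/2)\<^sup>2" by simp
        then have "norm (F x) \<le> 1 + (norm (F x))\<^sup>2" by (simp add: power2_eq_square algebra_simps)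
        then show ?thesis using True by (auto simp: abs_of_nonneg)
      qed (use elim in simp)
    qed
  qed simp
  from F AE iF sq show thesis by (rule that)
qed

section \<open>Distance to the boundary and its behaviour under small shifts\<close>

lemma ball_subset_inner_region:
  assumes x: "x \<in> inner_region \<Omega> r" and h: "norm h \<le> r / 2" "0 \<le> r"
  shows "x - h \<in> inner_region \<Omega> (r / 2)" and "ball x r \<subseteq> \<Omega>"
    and "infdist x (frontier \<Omega>) \<le> 2 * infdist (x - h) (frontier \<Omega>)"
proof -
  have d: "x \<in> \<Omega>" "infdist x (frontier \<Omega>) > r" using x by (auto simp: inner_region_def)
  show sub: "ball x r \<subseteq> \<Omega>"
  proof (rule ccontr)
    assume *: "\<not> ball x r \<subseteq> \<Omega>"
    then have "r > 0" by (metis ball_empty empty_subsetI not_less)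
    with d(1) have "x \<in> ball x r \<inter> \<Omega>" by simp
    moreover have "ball x r - \<Omega> \<noteq> {}" using * by blast
    \<comment> \<open>A ball is connected, so if it meets both \<Omega> and the complement it
      contains a boundary point, which would be closer than \<open>r\<close>.\<close>
    ultimately have "ball x r \<inter> frontier \<Omega> \<noteq> {}"
      by (intro connected_Int_frontier connected_ball) blast+
    then obtain p where "p \<in> frontier \<Omega>" "dist x p < r" by auto
    with infdist_le[of p "frontier \<Omega>" x] d(2) show False by linarith
  qed
  \<comment> \<open>The distance is 1-Lipschitz and exceeds \<open>r\<close>, so a shift of length
    at most \<open>r / 2\<close> uses up less than half of it.\<close>
  have tri: "infdist x (frontier \<Omega>) \<le> infdist (x - h) (frontier \<Omega>) + norm h"
    using infdist_triangle[of x "frontier \<Omega>" "x - h"] by (simp add: dist_norm)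
  have "x - h \<in> \<Omega>"
  proof (cases "r = 0")
    case False
    then have "x - h \<in> ball x r" using h by (simp add: dist_norm)
    with sub show ?thesis by blast
  qed (use d h in simp)
  with tri d h show "x - h \<in> inner_region \<Omega> (r / 2)" by (simp add: inner_region_def)
  show "infdist x (frontier \<Omega>) \<le> 2 * infdist (x - h) (frontier \<Omega>)" using tri d h by linarith
qed

text \<open>Boundedness of the weight is what makes the weighted gradient integral finite.\<close>

lemma bdist_bounded:
  assumes "bounded \<Omega>"
  obtains B where "\<And>x. \<bar>bdist \<Omega> x\<bar> \<le> B"
proof -
  obtain R where R: "\<And>x. x \<in> \<Omega> \<Longrightarrow> norm x \<le> R" using assms by (auto simp: bounded_iff)
  show thesis
  proof (cases "frontier \<Omega> = {}")
    case True
    \<comment> \<open>The distance to an empty set is 0 by convention.\<close>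
    then show ?thesis by (intro that[of 0]) (auto simp: bdist_def infdist_def)
  next
    case False
    then obtain p where p: "p \<in> frontier \<Omega>" by blast
    have "\<bar>bdist \<Omega> x\<bar> \<le> \<bar>R\<bar> + norm p" for x
    proof (cases "x \<in> \<Omega>")
      case True
      have "infdist x (frontier \<Omega>) \<le> norm x + norm p"
        using infdist_le[OF p, of x] norm_triangle_ineq4[of x p] by (simp add: dist_norm)
      then show ?thesis using R[OF True] True by (simp add: bdist_def infdist_nonneg)
    qed (simp add: bdist_def)
    then show ?thesis by (rule that)
  qed
qed

lemma measurable_bdist:
  assumes "open \<Omega>"
  shows "bdist \<Omega> \<in> borel_measurable borel"
proof -
  have [measurable]: "\<Omega> \<in> sets borel" using assms by simp
  have [measurable]: "(\<lambda>x. infdist x (frontier \<Omega>)) \<in> borel_measurable borel"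
    by (intro borel_measurable_continuous_onI continuous_intros)
  show ?thesis unfolding bdist_def by measurable
qed

lemma open_inner_region: "open \<Omega> \<Longrightarrow> open (inner_region \<Omega> r)"
  unfolding inner_region_def Collect_conj_eq
  by (intro open_Int open_Collect_less continuous_intros) auto

section \<open>Passage to Borel versions and transfer of the weighted estimate to real
  integrals\<close>

theorem lemma3p3:
  fixes \<zeta> :: "real^'n \<Rightarrow> real"
  assumes "CARD('n) \<ge> 3"
    and "\<zeta> \<in> test_functions (ball 0 (1/2))"
    and "(LINT x|lebesgue. \<zeta> x) = 1"
  shows "\<exists>C>0. \<forall>(\<Omega> :: (real^'n) set) (\<epsilon> :: real) (f :: real^'n \<Rightarrow> real) (g :: real^'n \<Rightarrow> real^'n).
           bounded_lipschitz_domain \<Omega> \<longrightarrow> \<epsilon> > 0 \<longrightarrow> f \<in> H1 \<Omega> \<longrightarrow>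
           g \<in> L2 \<Omega> \<longrightarrow> has_weak_gradient f g \<Omega> \<longrightarrow>
           (AE x in lebesgue. x \<in> \<Omega> - inner_region \<Omega> \<epsilon> \<longrightarrow> f x = 0) \<longrightarrow>
           sqrt (LINT x:inner_region \<Omega> (2 * \<epsilon>)|lebesgue.
                   \<bar>f x - smoothing \<zeta> \<Omega> \<epsilon> f x\<bar>\<^sup>2 * bdist \<Omega> x)
           \<le> C * \<epsilon> * sqrt (LINT x:inner_region \<Omega> \<epsilon>|lebesgue. (norm (g x))\<^sup>2 * bdist \<Omega> x)"
proof -
  interpret mollifier \<zeta> using assms by unfold_locales
  show ?thesis
  \<comment> \<open>The squared estimate carries the factor 2, hence the constant
    \<open>sqrt 2 * \<zeta>norm\<close>; enlarging 2 to 4 avoids the root. The value depends on the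
    kernel alone.\<close>
  proof (intro exI[of _ "2 * \<zeta>norm"] conjI allI impI)
    show "2 * \<zeta>norm > 0" using integral_abs_kernel_ge_1 by simp
    fix \<Omega> :: "(real^'n) set" and \<epsilon> :: real and f :: "real^'n \<Rightarrow> real" and g :: "real^'n \<Rightarrow> real^'n"
    assume dom: "bounded_lipschitz_domain \<Omega>" and \<epsilon>: "\<epsilon> > 0" and f: "f \<in> H1 \<Omega>" and g: "g \<in> L2 \<Omega>"
      and weak: "has_weak_gradient f g \<Omega>"
    have \<Omega>: "open \<Omega>" "bounded \<Omega>" using dom by (auto simp: bounded_lipschitz_domain_def)
    have "f \<in> L2 \<Omega>" using f by (simp add: H1_def)
    then obtain F where F [measurable]: "F \<in> borel_measurable borel" and
      AEF: "AE x in lborel. F x = indicator \<Omega> x *\<^sub>R f x" and iF: "integrable lborel F"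
      using \<Omega> by (rule L2_bounded_borel_representative)
    obtain G where G [measurable]: "G \<in> borel_measurable borel" and
      AEG: "AE x in lborel. G x = indicator \<Omega> x *\<^sub>R g x" and iG: "integrable lborel G"
      and iG2: "integrable lborel (\<lambda>x. (norm (G x))\<^sup>2)"
      using g \<Omega> by (rule L2_bounded_borel_representative)
    have [measurable]: "(\<lambda>x. G x $ i) \<in> borel_measurable borel" for i
      by (rule measurable_compose[OF G]) (intro borel_measurable_continuous_onI continuous_intros)
    interpret weak_gradient_pair \<zeta> \<Omega> F G
    proof
      fix \<phi> i assume \<phi>: "\<phi> \<in> test_functions \<Omega>"
      have Ck: "Ck k \<phi>" for k using \<phi> by (simp add: test_functions_def)
      have [measurable]: "\<phi> \<in> borel_measurable borel"
        using Ck[of 0] by (intro borel_measurable_continuous_onI) simp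
      have [measurable]: "(\<lambda>x. frechet_derivative \<phi> (at x) (axis i 1)) \<in> borel_measurable borel"
        using Ck[of "Suc 0"] by (intro borel_measurable_continuous_onI) simp
      have "(LINT z:\<Omega>|lebesgue. f z * frechet_derivative \<phi> (at z) (axis i 1)) =
          (LINT z|lborel. F z * frechet_derivative \<phi> (at z) (axis i 1))"
        unfolding set_lebesgue_integral_def
      proof (rule lebesgue_integral_borel_version(1))
        show "AE z in lborel. F z * frechet_derivative \<phi> (at z) (axis i 1) =
            indicator \<Omega> z *\<^sub>R (f z * frechet_derivative \<phi> (at z) (axis i 1))"
          using AEF by eventually_elim simp
      qed measurable
      moreover have "(LINT z:\<Omega>|lebesgue. g z $ i * \<phi> z) = (LINT z|lborel. G z $ i * \<phi> z)"
        unfolding set_lebesgue_integral_def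
      proof (rule lebesgue_integral_borel_version(1))
        show "AE z in lborel. G z $ i * \<phi> z = indicator \<Omega> z *\<^sub>R (g z $ i * \<phi> z)"
          using AEG by eventually_elim simp
      qed measurable
      ultimately show "(LINT z|lborel. F z * frechet_derivative \<phi> (at z) (axis i 1)) =
          - (LINT z|lborel. G z $ i * \<phi> z)"
        using weak \<phi> by (simp add: has_weak_gradient_def)
    qed (use iF iG in auto)
    have moll: "smoothing \<zeta> \<Omega> \<epsilon> f x = moll \<epsilon> x" for x
    proof -
      \<comment> \<open>The reflection taking \<open>y\<close> to \<open>x - y\<close> preserves
        null sets, so changing representatives leaves the convolution unchanged at every
        \<open>x\<close>, not just almost every one.\<close>
      have "AE y in lborel. F (x + (-1) *\<^sub>R y) = indicator \<Omega> (x + (-1) *\<^sub>R y) *\<^sub>R f (x + (-1) *\<^sub>R y)"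
        by (rule AE_lborel_affine[OF AEF]) simp
      then have "AE y in lborel. F (x - y) * rescaled \<zeta> \<epsilon> y = zero_extension \<Omega> f (x - y) * rescaled \<zeta> \<epsilon> y"
        by eventually_elim (auto simp: zero_extension_def)
      moreover have [measurable]: "rescaled \<zeta> \<epsilon> \<in> borel_measurable borel"
        unfolding rescaled_def by measurable
      ultimately have "smoothing \<zeta> \<Omega> \<epsilon> f x = (LINT y|lborel. F (x - y) * rescaled \<zeta> \<epsilon> y)"
        unfolding smoothing_def by (intro lebesgue_integral_borel_version) simp_all
      also have "\<dots> = moll \<epsilon> x"
        using \<epsilon> by (subst lborel_integral_affine[where t=0 and c=\<epsilon>]) (simp_all add: rescaled_def moll_def)
      finally show ?thesis .
    qed
    have [measurable]: "inner_region \<Omega> r \<in> sets borel" for r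
      using open_inner_region[OF \<Omega>(1)] by simp
    have [measurable]: "bdist \<Omega> \<in> borel_measurable borel" by (rule measurable_bdist[OF \<Omega>(1)])
    have b0: "bdist \<Omega> x \<ge> 0" for x by (simp add: bdist_def infdist_nonneg)
    \<comment> \<open>The weights of the two sides of the claim, extended by 0 from their inner
      regions.\<close>
    define W where "W x = indicator (inner_region \<Omega> (2 * \<epsilon>)) x * bdist \<Omega> x" for x
    define V where "V x = indicator (inner_region \<Omega> \<epsilon>) x * bdist \<Omega> x" for x
    have [measurable]: "W \<in> borel_measurable borel" "V \<in> borel_measurable borel"
      unfolding W_def V_def by measurable
    have W0: "W x \<ge> 0" and V0: "V x \<ge> 0" for x by (auto simp: W_def V_def b0)
    have W_inner: "x \<in> inner_region \<Omega> (2 * \<epsilon>)" if "W x \<noteq> 0" for x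
      using that by (auto simp: W_def indicator_def split: if_splits)
    have sub: "ball x (\<epsilon> / 2) \<subseteq> \<Omega>" if "W x \<noteq> 0" for x
      using ball_subset_inner_region(2)[OF W_inner[OF that], of 0] \<epsilon> by (auto simp: subset_iff)
    have WV: "W x \<le> 2 * V (x - h)" if h: "norm h \<le> \<epsilon> / 2" for x h
    proof (cases "W x = 0")
      case False
      \<comment> \<open>The geometric lemma is used with \<open>r = 2 * \<epsilon>\<close>, so that
        \<open>r / 2\<close> gives the region in which \<open>V\<close> lives.\<close>
      have "norm h \<le> 2 * \<epsilon> / 2" "0 \<le> 2 * \<epsilon>" using h \<epsilon> by auto
      from ball_subset_inner_region(1,3)[OF W_inner[OF False] this] W_inner[OF False]
      show ?thesis by (simp add: W_def V_def bdist_def inner_region_def)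
    qed (simp add: V0)
    obtain B where B: "\<And>x. \<bar>bdist \<Omega> x\<bar> \<le> B" using bdist_bounded[OF \<Omega>(2)] by blast
    \<comment> \<open>Finiteness of the right-hand integral identifies it with a real integral; a
      divergent one would have the default real value 0 and the bound could not be carried
      over.\<close>
    have "integrable lborel (\<lambda>x. (norm (G x))\<^sup>2 * V x)"
      by (rule integrable_bounded_mult[OF iG2, where B=B])
        (use B B[THEN order_trans[OF abs_ge_zero]] in \<open>auto simp: V_def indicator_def\<close>)
    then have A: "(\<integral>\<^sup>+z. ennreal (V z * (norm (G z))\<^sup>2) \<partial>lborel) = ennreal (LINT z|lborel. V z * (norm (G z))\<^sup>2)"
      by (intro nn_integral_eq_integral) (auto simp: mult.commute V0)
    have inner_sub: "x \<in> \<Omega>" if "x \<in> inner_region \<Omega> r" for x r using that by (simp add: inner_region_def)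
    have "(\<integral>\<^sup>+x. ennreal (W x * (F x - moll \<epsilon> x)\<^sup>2) \<partial>lborel) \<le>
        ennreal (2 * (\<epsilon> * \<zeta>norm)\<^sup>2) * (\<integral>\<^sup>+z. ennreal (V z * (norm (G z))\<^sup>2) \<partial>lborel)"
      by (rule weighted_moll_error_le) (use \<epsilon> W0 V0 sub WV in auto)
    also have "\<dots> = ennreal (2 * (\<epsilon> * \<zeta>norm)\<^sup>2 * (LINT z|lborel. V z * (norm (G z))\<^sup>2))"
      unfolding A by (rule ennreal_mult'[symmetric]) simp
    finally have "(LINT x|lborel. W x * (F x - moll \<epsilon> x)\<^sup>2) \<le> 2 * (\<epsilon> * \<zeta>norm)\<^sup>2 * (LINT z|lborel. V z * (norm (G z))\<^sup>2)"
      by (intro integral_le_nn_integral_bound) (auto simp: W0 V0 integral_nonneg_AE)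
    also have "\<dots> \<le> (2 * \<zeta>norm * \<epsilon>)\<^sup>2 * (LINT z|lborel. V z * (norm (G z))\<^sup>2)"
      by (intro mult_right_mono) (auto simp: power_mult_distrib V0 integral_nonneg_AE)
    finally have main: "(LINT x|lborel. W x * (F x - moll \<epsilon> x)\<^sup>2) \<le> (2 * \<zeta>norm * \<epsilon>)\<^sup>2 * (LINT z|lborel. V z * (norm (G z))\<^sup>2)" .
    have L: "(LINT x:inner_region \<Omega> (2 * \<epsilon>)|lebesgue. \<bar>f x - smoothing \<zeta> \<Omega> \<epsilon> f x\<bar>\<^sup>2 * bdist \<Omega> x) =
        (LINT x|lborel. W x * (F x - moll \<epsilon> x)\<^sup>2)"
      unfolding set_lebesgue_integral_def moll
    proof (rule lebesgue_integral_borel_version(1))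
      show "AE x in lborel. W x * (F x - moll \<epsilon> x)\<^sup>2 =
          indicator (inner_region \<Omega> (2 * \<epsilon>)) x *\<^sub>R (\<bar>f x - moll \<epsilon> x\<bar>\<^sup>2 * bdist \<Omega> x)"
        using AEF by eventually_elim (auto simp: W_def indicator_def dest: inner_sub)
    qed measurable
    have R: "(LINT x:inner_region \<Omega> \<epsilon>|lebesgue. (norm (g x))\<^sup>2 * bdist \<Omega> x) = (LINT z|lborel. V z * (norm (G z))\<^sup>2)"
      unfolding set_lebesgue_integral_def
    proof (rule lebesgue_integral_borel_version(1))
      show "AE z in lborel. V z * (norm (G z))\<^sup>2 =
          indicator (inner_region \<Omega> \<epsilon>) z *\<^sub>R ((norm (g z))\<^sup>2 * bdist \<Omega> z)"
        using AEG by eventually_elim (auto simp: V_def indicator_def dest: inner_sub)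
    qed measurable
    show "sqrt (LINT x:inner_region \<Omega> (2 * \<epsilon>)|lebesgue. \<bar>f x - smoothing \<zeta> \<Omega> \<epsilon> f x\<bar>\<^sup>2 * bdist \<Omega> x)
        \<le> 2 * \<zeta>norm * \<epsilon> * sqrt (LINT x:inner_region \<Omega> \<epsilon>|lebesgue. (norm (g x))\<^sup>2 * bdist \<Omega> x)"
      using real_sqrt_le_mono[OF main] \<epsilon> integral_abs_kernel_ge_1
      unfolding L R real_sqrt_mult by (simp add: abs_mult)
  qed
qed

end
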